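(* Consider the following 24 points $v_1,\dots,v_{24}$ of $\mathbb{R}^3$: $v_1=(-72,84,18)$, $v_2=(-36,112,102)$, $v_3=(72,-84,18)$, $v_4=(36,-112,102)$, $v_5=(0,300,234)$, $v_6=(-84,48,-18)$, $v_7=(9,147,207)$, $v_8=(0,-300,234)$, $v_9=(84,-48,-18)$, $v_{10}=(-112,-36,-102)$, $v_{11}=(48,84,18)$, $v_{12}=(-147,9,-207)$, $v_{13}=(-9,-147,207)$, $v_{14}=(84,72,-18)$, $v_{15}=(112,36,-102)$, $v_{16}=(-48,-84,18)$, $v_{17}=(147,-9,-207)$, $v_{18}=(-18,126,144)$, $v_{19}=(-126,-18,-144)$, $v_{20}=(-300,0,-234)$, $v_{21}=(-84,-72,-18)$, $v_{22}=(18,-126,144)$, $v_{23}=(126,18,-144)$, $v_{24}=(300,0,-234)$. Consider the following eight cyclic face walks, where $i$ stands for $v_i$ and the last vertex of each walk is joined to the first: $F_1$: $6-10-16-22-18-7-5-1-2$; $F_2$: $9-15-11-18-22-13-8-3-4$; $F_3$: $7-5-8-3-17-23-9-15-14$; $F_4$: $13-8-5-1-12-19-6-10-21$; $F_5$: $1-2-11-18-7-14-24-20-12$; $F_6$: $3-4-16-22-13-21-20-24-17$; $F_7$: $14-24-17-23-19-6-2-11-15$; $F_8$: $10-21-20-12-19-23-9-4-16$. Then these vertices and face walks, together with the planar faces defined by them (each $F_i$ being the planar polygonal region bounded by the closed polygon of its walk), form a closed orientable equivelar polyhedral surface of type $\{9,3\}$ and genus $3$. The surface has 24 vertices, 36 edges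 and eight faces, and its geometric symmetry group is isomorphic to the cyclic group $C_4$ of order $4$.
   Context: A face walk $w_1-w_2-\cdots-w_9$ specifies the cyclic order of the vertices of a face; its edges are the straight segments joining consecutive vertices, including the segment from $w_9$ to $w_1$. The face is the planar region bounded by the resulting closed polygon; being a planar simple polygonal face means that the nine vertices lie in a common plane and that the closed polygon they form in the given cyclic order is simple (non-self-intersecting). A polyhedral surface is a finite collection of planar simple polygonal faces in $\mathbb{R}^3$ such that the intersection of any two distinct faces is a (possibly empty) union of common vertices and common edges of the two faces, and such that, in the union of the faces, the local neighborhood of each vertex is homeomorphic to a disk. Two faces are allowed to share more than one edge. The vertices and edges of the surface are those of its faces. The surface is closed when every edge belongs to exactly two faces, and orientable when the faces admit compatible orientations, i.e. orientations such that the two orientations induced on every common edge by the two faces containing it are opposite. An equivelar surface (map) of type $\{p,q\}$ is one in which every face is a $p$-gon and every vertex has valence $q$ (here $p=9$, $q=3$: every face is a nonagon and exactly three faces meet at every vertex). The genus $g$ of a closed (connected) orientable surface is given by $V-E+F=2-2g$, where $V,E,F$ are the numbers of vertices, edges and faces. The geometric symmetry group of the surface is the group of Euclidean isometries of $\mathbb{R}^3$ that map the surface to itself, carrying vertices to vertices, edges to edges and faces to faces. *)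

theory Defs
  imports "HOL-Analysis.Analysis" "HOL-Algebra.Elementary_Groups"
begin

section \<open>Polygons given by cyclic vertex lists\<close>

type_synonym walk = "(real^3) list"

definition directed_edges :: "walk \<Rightarrow> ((real^3) \<times> (real^3)) set" where
  "directed_edges w = {(w ! i, w ! (Suc i mod length w)) | i. i < length w}"

definition walk_edges :: "walk \<Rightarrow> (real^3) set set" where
  "walk_edges w = {closed_segment a b | a b. (a, b) \<in> directed_edges w}"

definition polygon :: "walk \<Rightarrow> (real^3) set" where
  "polygon w = \<Union> (walk_edges w)"

text \<open>Non-self-intersecting: cyclically consecutive edges meet exactly in their common vertex,
  all other pairs of edges are disjoint.\<close>

definition simple_polygon :: "walk \<Rightarrow> bool" where
  "simple_polygon w \<longleftrightarrow> 3 \<le> length w \<and> distinct w \<and>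
     (let n = length w; e = (\<lambda>i. closed_segment (w ! i) (w ! (Suc i mod n))) in
       \<forall>i<n. \<forall>j<n. i \<noteq> j \<longrightarrow>
         e i \<inter> e j =
           (if j = Suc i mod n then {w ! j} else {}) \<union>
           (if i = Suc j mod n then {w ! i} else {}))"

text \<open>The closed region bounded by a planar polygon. Boundedness of components of the complement
  is taken relative to the plane spanned by the polygon, since a polygon does not separate
  three-dimensional space.\<close>

definition face_region :: "walk \<Rightarrow> (real^3) set" where
  "face_region w = polygon w \<union>
     {x \<in> affine hull set w - polygon w.
        bounded (connected_component_set (affine hull set w - polygon w) x)}"

definition planar_simple_face :: "walk \<Rightarrow> bool" where
  "planar_simple_face w \<longleftrightarrow> coplanar (set w) \<and> simple_polygon w"


section \<open>Polyhedral surfaces\<close>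

definition surface_vertices :: "walk set \<Rightarrow> (real^3) set" where
  "surface_vertices W = (\<Union>w\<in>W. set w)"

definition surface_edges :: "walk set \<Rightarrow> (real^3) set set" where
  "surface_edges W = (\<Union>w\<in>W. walk_edges w)"

definition surface_faces :: "walk set \<Rightarrow> (real^3) set set" where
  "surface_faces W = face_region ` W"

definition surface_union :: "walk set \<Rightarrow> (real^3) set" where
  "surface_union W = \<Union> (surface_faces W)"

text \<open>Local disk condition: each vertex has an open neighborhood, relative to the union of the
  faces, that is homeomorphic to the open disk, as usual for surfaces without boundary.\<close>

definition polyhedral_surface :: "walk set \<Rightarrow> bool" where
  "polyhedral_surface W \<longleftrightarrow>
     finite W \<and>
     (\<forall>w\<in>W. planar_simple_face w) \<and>
     (\<forall>w\<in>W. \<forall>w'\<in>W. w \<noteq> w' \<longrightarrow>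
        (\<exists>A B. A \<subseteq> set w \<inter> set w' \<and> B \<subseteq> walk_edges w \<inter> walk_edges w' \<and>
           face_region w \<inter> face_region w' = A \<union> \<Union> B)) \<and>
     (\<forall>x\<in>surface_vertices W.
        \<exists>U. openin (top_of_set (surface_union W)) U \<and> x \<in> U \<and>
            U homeomorphic ball (0::real^2) 1)"

definition closed_surface :: "walk set \<Rightarrow> bool" where
  "closed_surface W \<longleftrightarrow> (\<forall>e\<in>surface_edges W. card {w \<in> W. e \<in> walk_edges w} = 2)"

text \<open>An orientation of a face is a choice of one of the two directions of traversal of its
  boundary.\<close>

definition orientable_surface :: "walk set \<Rightarrow> bool" where
  "orientable_surface W \<longleftrightarrow>
     (\<exists>orient :: walk \<Rightarrow> walk. (\<forall>w\<in>W. orient w = w \<or> orient w = rev w) \<and>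
        (\<forall>w\<in>W. \<forall>w'\<in>W. w \<noteq> w' \<longrightarrow>
           (\<forall>a b. (a, b) \<in> directed_edges (orient w) \<and> closed_segment a b \<in> walk_edges w' \<longrightarrow>
              (b, a) \<in> directed_edges (orient w'))))"

text \<open>Valence q is required both for the edges ending at a vertex and for the faces meeting there.
  As edges are segments, their endpoints are their extreme points.\<close>

definition equivelar :: "walk set \<Rightarrow> nat \<Rightarrow> nat \<Rightarrow> bool" where
  "equivelar W p q \<longleftrightarrow>
     (\<forall>w\<in>W. length w = p) \<and>
     (\<forall>x\<in>surface_vertices W.
        card {e \<in> surface_edges W. x extreme_point_of e} = q \<and>
        card {w \<in> W. x \<in> set w} = q)"

definition has_genus :: "walk set \<Rightarrow> int \<Rightarrow> bool" where
  "has_genus W g \<longleftrightarrow>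
     closed_surface W \<and> orientable_surface W \<and> connected (surface_union W) \<and>
     int (card (surface_vertices W)) - int (card (surface_edges W))
       + int (card (surface_faces W)) = 2 - 2 * g"

definition surface_symmetries :: "walk set \<Rightarrow> ((real^3) \<Rightarrow> (real^3)) set" where
  "surface_symmetries W =
     {f. (\<forall>x y. dist (f x) (f y) = dist x y) \<and>
         f ` surface_union W = surface_union W \<and>
         f ` surface_vertices W = surface_vertices W \<and>
         (`) f ` surface_edges W = surface_edges W \<and>
         (`) f ` surface_faces W = surface_faces W}"

definition symmetry_group :: "walk set \<Rightarrow> ((real^3) \<Rightarrow> (real^3)) monoid" where
  "symmetry_group W =
     \<lparr>carrier = surface_symmetries W, mult = (\<circ>), one = id\<rparr>"


section \<open>The surface with eight nonagons\<close>

definition vertex_list :: "(real^3) list" where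
  "vertex_list = map vector [
     [-72, 84, 18], [-36, 112, 102], [72, -84, 18], [36, -112, 102],
     [0, 300, 234], [-84, 48, -18], [9, 147, 207], [0, -300, 234],
     [84, -48, -18], [-112, -36, -102], [48, 84, 18], [-147, 9, -207],
     [-9, -147, 207], [84, 72, -18], [112, 36, -102], [-48, -84, 18],
     [147, -9, -207], [-18, 126, 144], [-126, -18, -144], [-300, 0, -234],
     [-84, -72, -18], [18, -126, 144], [126, 18, -144], [300, 0, -234]]"

text \<open>Vertices are numbered from 1 to 24 and faces from 1 to 8, list positions from 0.\<close>

definition vert :: "nat \<Rightarrow> real^3" where
  "vert i = vertex_list ! (i - 1)"

definition face_walk :: "nat \<Rightarrow> walk" where
  "face_walk k = map vert ([
     [6, 10, 16, 22, 18, 7, 5, 1, 2],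
     [9, 15, 11, 18, 22, 13, 8, 3, 4],
     [7, 5, 8, 3, 17, 23, 9, 15, 14],
     [13, 8, 5, 1, 12, 19, 6, 10, 21],
     [1, 2, 11, 18, 7, 14, 24, 20, 12],
     [3, 4, 16, 22, 13, 21, 20, 24, 17],
     [14, 24, 17, 23, 19, 6, 2, 11, 15],
     [10, 21, 20, 12, 19, 23, 9, 4, 16]] ! (k - 1))"

definition nonagon_surface :: "walk set" where
  "nonagon_surface = face_walk ` {1..8}"

end

theory Submission
  imports Defs
begin

text \<open>Counts, valences, orientability and closedness are finite checks on the indices 1 to 24. The content
lies in the passage from vertex lists to regions, neighborhoods and isometries.

\<^bold>\<open>Regions.\<close> No face plane is vertical, so a face is determined by its shadow in the xy-plane. The shadow
nonagon is grown from one triangle by attaching six more along edges. Each step preserves the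
invariants collected in \<open>polygonal_disk\<close>, in particular that the region is a compact absolute retract
and that it is open away from the outline (\<open>polygonal_disk_add_ear\<close>). The complement of a compact absolute
retract in the plane is connected, so nothing but the grown region can be enclosed by the outline
(\<open>face_region_lift\<close>). This replaces the Jordan curve theorem.

\<^bold>\<open>Intersections.\<close> Each face is a union of two or three convex pieces. Pieces of different faces lie on
opposite sides of a plane, usually one of the two face planes, that touches one of the pieces only in a
vertex or edge common to both faces (\<open>faces_intersection\<close>).

\<^bold>\<open>Vertices.\<close> Three faces meet at a vertex, at most one of them with a reflex angle. In coordinates along the
three edges the union of the three corners is the zero set of \<open>min t\<^sub>1 (min t\<^sub>2 t\<^sub>3)\<close> or of
\<open>max (- t\<^sub>2) (min t\<^sub>1 t\<^sub>3)\<close>. Such a function grows at unit rate along a fixed direction, so its zero set is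
a graph over a plane (\<open>disk_at_vertex\<close>).

\<^bold>\<open>Symmetries.\<close> The map \<open>(x, y, z) \<mapsto> (- y, x, - z)\<close> permutes the faces. Conversely, the largest distance
between vertices is attained exactly between \<open>{5, 8}\<close> and \<open>{20, 24}\<close>. A symmetry therefore permutes the corners
of this tetrahedron and is one of its eight symmetries (\<open>isometry_signed_map\<close>); four of those move
vertex 1 to a point that is not a vertex (\<open>symmetries_nonagon\<close>).\<close>

section \<open>Orientation and triangles in the plane\<close>

type_synonym plane = "real \<times> real"

definition cross2 :: "plane \<Rightarrow> plane \<Rightarrow> real" where
  "cross2 a b = fst a * snd b - snd a * fst b"

definition orient :: "plane \<Rightarrow> plane \<Rightarrow> plane \<Rightarrow> real" where
  "orient a b c = cross2 (b - a) (c - a)"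

lemma orient_rotate: "orient b c a = orient a b c"
  by (simp add: orient_def cross2_def algebra_simps)

lemma orient_swap: "orient b a c = - orient a b c"
  by (simp add: orient_def cross2_def algebra_simps)

lemma orient_same [simp]: "orient a a b = 0" "orient a b a = 0" "orient a b b = 0"
  by (simp_all add: orient_def cross2_def)

lemma eventually_orient_pos: "orient a b x > 0 \<Longrightarrow> \<forall>\<^sub>F y in nhds x. orient a b y > 0"
proof -
  assume "orient a b x > 0"
  moreover have "isCont (orient a b) x"
    unfolding orient_def cross2_def by (intro continuous_intros)
  ultimately show ?thesis
    by (metis isCont_def order_tendstoD(1) tendsto_at_iff_tendsto_nhds)
qed

text \<open>Barycentric coordinates are the quotients of the signed areas of the subtriangles at \<open>p\<close>.\<close>

lemma barycentric:
  assumes "orient a b c \<noteq> 0"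
  shows "p = (orient b c p / orient a b c) *\<^sub>R a + (orient c a p / orient a b c) *\<^sub>R b
           + (orient a b p / orient a b c) *\<^sub>R c"
    and "orient b c p / orient a b c + orient c a p / orient a b c + orient a b p / orient a b c = 1"
proof -
  have s: "orient b c p + orient c a p + orient a b p = orient a b c"
    by (simp add: orient_def cross2_def algebra_simps)
  then show "orient b c p / orient a b c + orient c a p / orient a b c + orient a b p / orient a b c = 1"
    using assms by (metis add_divide_distrib divide_self)
  have "orient a b c *\<^sub>R p = orient b c p *\<^sub>R a + orient c a p *\<^sub>R b + orient a b p *\<^sub>R c"
    by (simp add: prod_eq_iff orient_def cross2_def algebra_simps)
  then have "p = (1 / orient a b c) *\<^sub>R (orient b c p *\<^sub>R a + orient c a p *\<^sub>R b + orient a b p *\<^sub>R c)"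
    using assms by (metis divide_inverse_commute inverse_eq_divide mult.right_neutral real_vector.scale_one
        real_vector.scale_scale right_inverse mult.commute)
  then show "p = (orient b c p / orient a b c) *\<^sub>R a + (orient c a p / orient a b c) *\<^sub>R b
           + (orient a b p / orient a b c) *\<^sub>R c"
    by (simp add: scaleR_right_distrib)
qed

lemma orient_convex_combination:
  assumes "u + v + w = 1"
  shows "orient p q (u *\<^sub>R a + v *\<^sub>R b + w *\<^sub>R c) = u * orient p q a + v * orient p q b + w * orient p q c"
proof -
  have "orient p q (u *\<^sub>R a + v *\<^sub>R b + w *\<^sub>R c) - (u * orient p q a + v * orient p q b + w * orient p q c)
      = (1 - (u + v + w)) * orient p q 0"
    by (simp add: orient_def cross2_def algebra_simps)
  then show ?thesis using assms by simp
qed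

lemma triangle_halfplanes:
  assumes "orient a b c > 0"
  shows "convex hull {a, b, c} = {p. orient a b p \<ge> 0 \<and> orient b c p \<ge> 0 \<and> orient c a p \<ge> 0}"
proof (intro Set.set_eqI iffI)
  fix p assume "p \<in> convex hull {a, b, c}"
  then obtain u v w where p: "p = u *\<^sub>R a + v *\<^sub>R b + w *\<^sub>R c" "0 \<le> u" "0 \<le> v" "0 \<le> w" "u + v + w = 1"
    by (auto simp: convex_hull_3)
  have "orient b c a = orient a b c" "orient c a b = orient a b c"
    by (simp_all add: orient_rotate)
  then show "p \<in> {p. orient a b p \<ge> 0 \<and> orient b c p \<ge> 0 \<and> orient c a p \<ge> 0}"
    using p assms by (simp add: orient_convex_combination)
next
  fix p assume "p \<in> {p. orient a b p \<ge> 0 \<and> orient b c p \<ge> 0 \<and> orient c a p \<ge> 0}"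
  then show "p \<in> convex hull {a, b, c}"
    unfolding convex_hull_3 mem_Collect_eq
    using barycentric[of a b c p] assms
    by (intro exI[of _ "orient b c p / orient a b c"] exI[of _ "orient c a p / orient a b c"]
         exI[of _ "orient a b p / orient a b c"]) auto
qed

lemma triangle_edge:
  assumes "orient a b c > 0" "p \<in> convex hull {a, b, c}" "orient a b p = 0"
  shows "p \<in> closed_segment a b"
proof -
  have "p = (orient b c p / orient a b c) *\<^sub>R a + (orient c a p / orient a b c) *\<^sub>R b"
    "orient b c p / orient a b c + orient c a p / orient a b c = 1"
    using barycentric[of a b c p] assms by auto
  moreover have "orient b c p / orient a b c \<ge> 0" "orient c a p / orient a b c \<ge> 0"
    using assms triangle_halfplanes[OF assms(1)] by auto
  ultimately show ?thesis
    unfolding closed_segment_def mem_Collect_eq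
    by (intro exI[of _ "orient c a p / orient a b c"]) (simp add: add.commute eq_diff_eq[symmetric])
qed

lemma orient_open_segment:
  assumes "orient a b c > 0" "x \<in> open_segment a b"
  shows "orient a b x = 0" "orient b c x > 0" "orient c a x > 0"
proof -
  obtain u where u: "0 < u" "u < 1" "x = (1 - u) *\<^sub>R a + u *\<^sub>R b"
    using assms(2) by (auto simp: in_segment)
  have *: "orient p q x = (1 - u) * orient p q a + u * orient p q b" for p q
    using orient_convex_combination[of "1 - u" u 0 p q a b 0] u by simp
  show "orient a b x = 0" by (simp add: *)
  show "orient b c x > 0" "orient c a x > 0"
    unfolding * using u(1,2) assms(1) orient_rotate[of a b c] orient_rotate[of b c a] by simp_all
qed


section \<open>Angular sectors\<close>

text \<open>The closed sector swept counterclockwise from the direction \<open>a\<close> to the direction \<open>b\<close>. It is an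
intersection of two half planes up to a half turn and their union beyond it.\<close>

definition sector :: "plane \<Rightarrow> plane \<Rightarrow> plane set" where
  "sector a b = {y. if cross2 a b > 0 then cross2 a y \<ge> 0 \<and> cross2 y b \<ge> 0
                    else cross2 a y \<ge> 0 \<or> cross2 y b \<ge> 0}"

text \<open>The equation is the Pluecker relation between four vectors of the plane, so two of the signs
of \<open>A\<close>, \<open>B\<close>, \<open>C\<close> constrain the third.\<close>

lemma sector_signs:
  fixes P Q S A B C :: real
  assumes e: "P * C + Q * A + S * B = 0" "Q > 0" "P > 0 \<or> S > 0"
  shows "((if P > 0 then A \<ge> 0 \<and> B \<le> 0 else A \<ge> 0 \<or> B \<le> 0) \<or> (B \<ge> 0 \<and> C \<le> 0))
      \<longleftrightarrow> (if S < 0 then A \<ge> 0 \<and> C \<le> 0 else A \<ge> 0 \<or> C \<le> 0)"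
proof -
  have sign_P: "C \<le> 0" if "P > 0" "P * C \<le> 0" using that by (simp add: mult_le_0_iff)
  have sign_Q: "A \<ge> 0" if "Q * A \<ge> 0" using that e(2) by (simp add: zero_le_mult_iff)
  show ?thesis
  proof (cases "P > 0")
    case True
    show ?thesis
    proof (cases "S < 0")
      case True
      have "A \<ge> 0" if "B \<ge> 0" "C \<le> 0"
      proof (rule sign_Q)
        have "P * C \<le> 0" "S * B \<le> 0" using that True \<open>P > 0\<close> by (simp_all add: mult_le_0_iff)
        then show "Q * A \<ge> 0" using e(1) by linarith
      qed
      moreover have "C \<le> 0" if "A \<ge> 0" "B \<le> 0"
      proof (rule sign_P)
        have "Q * A \<ge> 0" "S * B \<ge> 0" using that True e(2) by (simp_all add: zero_le_mult_iff)
        then show "P * C \<le> 0" using e(1) by linarith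
      qed (use \<open>P > 0\<close> in simp)
      ultimately show ?thesis using True \<open>P > 0\<close> by auto
    next
      case False
      have "C \<le> 0" if "A \<ge> 0" "B \<ge> 0"
      proof (rule sign_P)
        have "Q * A \<ge> 0" "S * B \<ge> 0" using that False e(2) by (simp_all add: zero_le_mult_iff)
        then show "P * C \<le> 0" using e(1) by linarith
      qed (use \<open>P > 0\<close> in simp)
      moreover have "A \<ge> 0" if "B \<le> 0" "C \<le> 0"
      proof (rule sign_Q)
        have "P * C \<le> 0" "S * B \<le> 0" using that False \<open>P > 0\<close> by (simp_all add: mult_le_0_iff)
        then show "Q * A \<ge> 0" using e(1) by linarith
      qed
      ultimately show ?thesis
        using False \<open>P > 0\<close> by (cases "B \<le> 0") auto
    qed
  next
    case False
    then have "S > 0" using e by auto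
    have "C \<le> 0" if "A < 0" "B \<le> 0"
    proof -
      have "Q * A < 0" "S * B \<le> 0" using that \<open>S > 0\<close> e(2) by (simp_all add: mult_le_0_iff mult_less_0_iff)
      then have "P * C > 0" using e(1) by linarith
      then show ?thesis using False by (auto simp: zero_less_mult_iff)
    qed
    then show ?thesis
      using False \<open>S > 0\<close> by force
  qed
qed

text \<open>The second hypothesis bounds the total angle by a full turn; without it the sectors could overlap.\<close>

lemma sector_add_right:
  assumes bc: "cross2 b c > 0" and no_overlap: "cross2 a b > 0 \<or> cross2 c a > 0"
  shows "sector a b \<union> sector b c = sector a c"
proof (rule Set.set_eqI)
  fix y
  have plucker: "cross2 a b * cross2 c y + cross2 b c * cross2 a y + cross2 c a * cross2 b y = 0"
    by (simp add: cross2_def algebra_simps)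
  have sw: "0 \<le> cross2 y b \<longleftrightarrow> cross2 b y \<le> 0" "0 \<le> cross2 y c \<longleftrightarrow> cross2 c y \<le> 0"
    "0 < cross2 a c \<longleftrightarrow> cross2 c a < 0"
    by (auto simp: cross2_def algebra_simps)
  show "y \<in> sector a b \<union> sector b c \<longleftrightarrow> y \<in> sector a c"
    using sector_signs[OF plucker bc no_overlap] bc unfolding sector_def Un_iff mem_Collect_eq sw
    by (simp only: if_True)
qed

text \<open>Exchanging the coordinates reverses the orientation and turns this into \<open>sector_add_right\<close>.\<close>

lemma sector_add_left:
  assumes ab: "cross2 a b > 0" and no_overlap: "cross2 b c > 0 \<or> cross2 c a > 0"
  shows "sector a b \<union> sector b c = sector a c"
proof -
  have mirror: "y \<in> sector p q \<longleftrightarrow> prod.swap y \<in> sector (prod.swap q) (prod.swap p)" for y p q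
    by (auto simp: sector_def cross2_def prod.swap_def algebra_simps)
  have sw: "cross2 (prod.swap p) (prod.swap q) = cross2 q p" for p q
    by (simp add: cross2_def algebra_simps)
  have "sector (prod.swap c) (prod.swap b) \<union> sector (prod.swap b) (prod.swap a)
      = sector (prod.swap c) (prod.swap a)"
    by (rule sector_add_right) (use assms in \<open>simp_all add: sw\<close>)
  then show ?thesis
    by (auto simp: mirror[of _ a b] mirror[of _ b c] mirror[of _ a c])
qed

section \<open>Regions grown from triangles\<close>

definition outline :: "(plane \<times> plane) set \<Rightarrow> plane set" where
  "outline E = (\<Union>(a, b)\<in>E. closed_segment a b)"

text \<open>The edges in \<open>E\<close> are directed with the region to their left. The clause on open edges and the clause on corners
describe the region near its boundary. The first is needed to keep the region open when a triangle is
attached along an edge; the second gives the shape of a face at its vertices, from which the disk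
neighborhoods are built.\<close>

definition polygonal_disk :: "(plane \<times> plane) set \<Rightarrow> plane set \<Rightarrow> bool" where
  "polygonal_disk E R \<longleftrightarrow>
     finite E \<and> single_valued E \<and> single_valued (E\<inverse>) \<and>
     compact R \<and> AR R \<and> outline E \<subseteq> R \<and> open (R - outline E) \<and>
     (\<forall>a b x. (a, b) \<in> E \<longrightarrow> x \<in> open_segment a b \<longrightarrow>
        (\<forall>\<^sub>F y in nhds x. orient a b y \<ge> 0 \<longrightarrow> y \<in> R)) \<and>
     (\<forall>u v x. (u, v) \<in> E \<longrightarrow> (v, x) \<in> E \<longrightarrow>
        (\<forall>\<^sub>F y in nhds v. y \<in> R \<longleftrightarrow> y - v \<in> sector (x - v) (u - v)))"

lemma open_iff_eventually: "open S \<longleftrightarrow> (\<forall>x\<in>S. \<forall>\<^sub>F y in nhds x. y \<in> S)"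
  by (metis eventually_nhds open_subopen subsetD subsetI)

lemma compact_outline: "finite E \<Longrightarrow> compact (outline E)"
  unfolding outline_def by (intro compact_UN) auto

lemma eventually_not_in_closed: "closed S \<Longrightarrow> x \<notin> S \<Longrightarrow> \<forall>\<^sub>F y in nhds x. y \<notin> S"
  using eventually_nhds_in_open[of "- S" x] by (simp add: open_Compl)

lemma triangle_open_interior:
  assumes "orient a b c > 0" "x \<in> convex hull {a, b, c}"
    "x \<notin> closed_segment a b" "x \<notin> closed_segment b c" "x \<notin> closed_segment c a"
  shows "\<forall>\<^sub>F y in nhds x. y \<in> convex hull {a, b, c}"
proof -
  have rot: "orient b c a > 0" "orient c a b > 0" "convex hull {b, c, a} = convex hull {a, b, c}"
    "convex hull {c, a, b} = convex hull {a, b, c}"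
    using assms(1) orient_rotate[of a b c] orient_rotate[of b c a] by (simp_all add: insert_commute)
  have "orient a b x \<noteq> 0" "orient b c x \<noteq> 0" "orient c a x \<noteq> 0"
    using triangle_edge[OF assms(1,2)] triangle_edge[OF rot(1), of x] triangle_edge[OF rot(2), of x] assms rot
    by auto
  then have "orient a b x > 0" "orient b c x > 0" "orient c a x > 0"
    using assms(2) unfolding triangle_halfplanes[OF assms(1)] by auto
  then have "\<forall>\<^sub>F y in nhds x. orient a b y > 0 \<and> orient b c y > 0 \<and> orient c a y > 0"
    by (simp add: eventually_conj_iff eventually_orient_pos)
  then show ?thesis
    by (rule eventually_mono) (simp add: triangle_halfplanes[OF assms(1)])
qed

lemma triangle_left_of_edge:
  assumes "orient a b c > 0" "x \<in> open_segment a b"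
  shows "\<forall>\<^sub>F y in nhds x. orient a b y \<ge> 0 \<longrightarrow> y \<in> convex hull {a, b, c}"
proof -
  have "\<forall>\<^sub>F y in nhds x. orient b c y > 0 \<and> orient c a y > 0"
    using orient_open_segment[OF assms] by (simp add: eventually_conj_iff eventually_orient_pos)
  then show ?thesis
    by (rule eventually_mono) (simp add: triangle_halfplanes[OF assms(1)])
qed

lemma triangle_corner:
  assumes "orient a b c > 0"
  shows "\<forall>\<^sub>F y in nhds b. y \<in> convex hull {a, b, c} \<longleftrightarrow> y - b \<in> sector (c - b) (a - b)"
proof -
  have "orient c a b > 0"
    using assms by (simp add: orient_rotate orient_rotate[of b c a])
  then have "\<forall>\<^sub>F y in nhds b. orient c a y > 0"
    by (rule eventually_orient_pos)
  moreover have "cross2 (c - b) (a - b) > 0" "\<And>y. cross2 (c - b) (y - b) = orient b c y"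
     "\<And>y. cross2 (y - b) (a - b) = orient a b y"
    using assms by (simp_all add: orient_def cross2_def algebra_simps)
  ultimately show ?thesis
    by (auto simp: triangle_halfplanes[OF assms] sector_def elim!: eventually_mono)
qed

lemma triangle_vertices_distinct:
  assumes "orient a b c > 0"
  shows "a \<noteq> b" "b \<noteq> c" "a \<noteq> c"
  using assms by auto

lemma polygonal_disk_triangle:
  assumes "orient a b c > 0"
  shows "polygonal_disk {(a, b), (b, c), (c, a)} (convex hull {a, b, c})" (is "polygonal_disk ?E ?T")
proof -
  have rot: "orient b c a > 0" "orient c a b > 0" "convex hull {b, c, a} = convex hull {a, b, c}"
    "convex hull {c, a, b} = convex hull {a, b, c}"
    using assms orient_rotate[of a b c] orient_rotate[of b c a] by (simp_all add: insert_commute)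
  note ne = triangle_vertices_distinct[OF assms]
  have out: "outline ?E \<subseteq> ?T"
    using hull_mono[of "{a, b}" "{a, b, c}" convex] hull_mono[of "{b, c}" "{a, b, c}" convex]
      hull_mono[of "{c, a}" "{a, b, c}" convex]
    by (simp add: outline_def segment_convex_hull)
  have "open (?T - outline ?E)"
    unfolding open_iff_eventually
  proof
    fix x assume x: "x \<in> ?T - outline ?E"
    then have "\<forall>\<^sub>F y in nhds x. y \<in> ?T"
      by (intro triangle_open_interior assms) (auto simp: outline_def)
    moreover have "\<forall>\<^sub>F y in nhds x. y \<notin> outline ?E"
      using x by (intro eventually_not_in_closed compact_imp_closed compact_outline) auto
    ultimately show "\<forall>\<^sub>F y in nhds x. y \<in> ?T - outline ?E"
      by eventually_elim simp
  qed
  moreover have "AR ?T"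
    by (intro convex_imp_AR) auto
  moreover have "compact ?T"
    by (intro finite_imp_compact_convex_hull) auto
  moreover have "\<forall>\<^sub>F y in nhds x. orient p q y \<ge> 0 \<longrightarrow> y \<in> ?T"
    if "(p, q) \<in> ?E" "x \<in> open_segment p q" for p q x
    using that triangle_left_of_edge[OF assms] triangle_left_of_edge[OF rot(1), unfolded rot(3)]
      triangle_left_of_edge[OF rot(2), unfolded rot(4)] by blast
  moreover have "\<forall>\<^sub>F y in nhds v. y \<in> ?T \<longleftrightarrow> y - v \<in> sector (x - v) (u - v)"
    if "(u, v) \<in> ?E" "(v, x) \<in> ?E" for u v x
  proof -
    have "(u = a \<and> v = b \<and> x = c) \<or> (u = b \<and> v = c \<and> x = a) \<or> (u = c \<and> v = a \<and> x = b)"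
      using that ne by auto
    then show ?thesis
      using triangle_corner[OF assms] triangle_corner[OF rot(1), unfolded rot(3)]
        triangle_corner[OF rot(2), unfolded rot(4)] by blast
  qed
  moreover have "single_valued ?E" "single_valued (?E\<inverse>)"
    using ne by (auto simp: single_valued_def)
  ultimately show ?thesis
    unfolding polygonal_disk_def using out by blast
qed

lemma eventually_mem_Un_sector:
  assumes "\<forall>\<^sub>F y in nhds v. y \<in> R \<longleftrightarrow> y - v \<in> sector a b"
    and "\<forall>\<^sub>F y in nhds v. y \<in> T \<longleftrightarrow> y - v \<in> sector c d"
    and "sector a b \<union> sector c d = sector e f"
  shows "\<forall>\<^sub>F y in nhds v. y \<in> R \<union> T \<longleftrightarrow> y - v \<in> sector e f"
  using assms(1,2) by eventually_elim (use assms(3) in auto)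

text \<open>Attaching a triangle along the chord from \<open>a\<close> to \<open>b\<close> adds to the interior the open triangle and the open
chord, and near the chord the old region covers the left and the triangle the right side. The union is an absolute
retract because the two parts meet in a segment. Corners change only at \<open>a\<close> and \<open>b\<close>, where sectors
are added; \<open>at_a\<close> and \<open>at_b\<close> say that the angles there stay below a full turn.\<close>

lemma polygonal_disk_add_ear:
  assumes disk: "polygonal_disk E R" and ab: "(a, b) \<in> E" and ear: "orient a c b > 0"
    and meet: "R \<inter> convex hull {a, c, b} \<subseteq> closed_segment a b"
    and off_chord: "\<And>u v. (u, v) \<in> E \<Longrightarrow> v \<noteq> a \<Longrightarrow> v \<noteq> b \<Longrightarrow> v \<notin> closed_segment a b"
    and at_a: "\<And>u. (u, a) \<in> E \<Longrightarrow> orient a b u > 0 \<or> orient a u c > 0"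
    and at_b: "\<And>x. (b, x) \<in> E \<Longrightarrow> orient b x a > 0 \<or> orient b c x > 0"
  shows "polygonal_disk (E - {(a, b)} \<union> {(a, c), (c, b)}) (R \<union> convex hull {a, c, b})"
    (is "polygonal_disk ?E (R \<union> ?T)")
proof -
  have fin: "finite E" and sv: "single_valued E" "single_valued (E\<inverse>)"
    and R: "compact R" "AR R" "outline E \<subseteq> R" "open (R - outline E)"
    and left: "\<And>a b x. (a, b) \<in> E \<Longrightarrow> x \<in> open_segment a b \<Longrightarrow>
        \<forall>\<^sub>F y in nhds x. orient a b y \<ge> 0 \<longrightarrow> y \<in> R"
    and corner: "\<And>u v x. (u, v) \<in> E \<Longrightarrow> (v, x) \<in> E \<Longrightarrow>
        \<forall>\<^sub>F y in nhds v. y \<in> R \<longleftrightarrow> y - v \<in> sector (x - v) (u - v)"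
    using disk unfolding polygonal_disk_def by blast+
  note ne = triangle_vertices_distinct[OF ear]
  have rot: "orient c b a > 0" "orient b a c > 0" "convex hull {c, b, a} = ?T" "convex hull {b, a, c} = ?T"
    using ear orient_rotate[of a c b] orient_rotate[of c b a] by (simp_all add: insert_commute)
  have T: "compact ?T" "AR ?T"
    by (auto intro: finite_imp_compact_convex_hull convex_imp_AR)
  have segments: "closed_segment a c \<subseteq> ?T" "closed_segment c b \<subseteq> ?T" "closed_segment a b \<subseteq> ?T"
    unfolding segment_convex_hull by (intro hull_mono; auto)+
  have chord: "closed_segment a b \<subseteq> R"
    using ab R(3) by (auto simp: outline_def)
  have c: "c \<notin> R"
  proof
    assume "c \<in> R"
    then have "c \<in> closed_segment a b"
      using meet hull_inc[of c "{a, c, b}"] by auto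
    then have "c \<in> open_segment a b"
      using ne by (auto simp: open_segment_def)
    moreover have "orient b a c > 0" by (fact rot(2))
    ultimately show False
      using orient_open_segment(1)[of b a c c] by (simp add: open_segment_commute)
  qed
  have vertices: "u \<in> R" "v \<in> R" if "(u, v) \<in> E" for u v
    using that R(3) by (auto simp: outline_def)
  have outline': "closed_segment p q \<subseteq> outline ?E" if "(p, q) \<in> E" "(p, q) \<noteq> (a, b)" for p q
    using that by (auto simp: outline_def)
  have new: "closed_segment a c \<subseteq> outline ?E" "closed_segment c b \<subseteq> outline ?E"
    by (auto simp: outline_def)
  have "outline ?E \<subseteq> outline E \<union> closed_segment a c \<union> closed_segment c b"
    by (auto simp: outline_def)
  then have out: "outline ?E \<subseteq> R \<union> ?T"
    using R(3) segments by blast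
  have "\<forall>\<^sub>F y in nhds x. y \<in> R \<union> ?T" if x: "x \<in> R \<union> ?T" "x \<notin> outline ?E" for x
  proof -
    \<comment> \<open>the old interior, the open chord, the new triangle\<close>
    consider "x \<in> R - outline E" | "x \<in> outline E" | "x \<in> ?T" "x \<notin> closed_segment a b"
      using x chord by blast
    then show ?thesis
    proof cases
      case 1
      then have "\<forall>\<^sub>F y in nhds x. y \<in> R - outline E"
        using R(4) by (intro eventually_nhds_in_open)
      then show ?thesis by (rule eventually_mono) simp
    next
      case 2
      then obtain p q where "(p, q) \<in> E" "x \<in> closed_segment p q"
        by (auto simp: outline_def)
      then have "x \<in> closed_segment a b"
        using x(2) outline'[of p q] by blast
      moreover have "x \<noteq> a" "x \<noteq> b"
        using x(2) new by auto
      ultimately have "x \<in> open_segment a b" "x \<in> open_segment b a"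
        by (auto simp: open_segment_def closed_segment_commute)
      then have "\<forall>\<^sub>F y in nhds x. orient a b y \<ge> 0 \<longrightarrow> y \<in> R" "\<forall>\<^sub>F y in nhds x. orient b a y \<ge> 0 \<longrightarrow> y \<in> ?T"
        using left[OF ab] triangle_left_of_edge[OF rot(2)] unfolding rot(4) by auto
      then show ?thesis
        by eventually_elim (auto simp: orient_swap[of b a])
    next
      case 3
      then have "\<forall>\<^sub>F y in nhds x. y \<in> ?T"
        using x(2) new by (intro triangle_open_interior ear) (auto simp: closed_segment_commute)
      then show ?thesis by (rule eventually_mono) simp
    qed
  qed
  moreover have "\<forall>\<^sub>F y in nhds x. y \<notin> outline ?E" if "x \<notin> outline ?E" for x
    using that fin by (intro eventually_not_in_closed compact_imp_closed compact_outline) auto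
  ultimately have "open (R \<union> ?T - outline ?E)"
    unfolding open_iff_eventually by (auto simp: eventually_conj_iff)
  moreover have "AR (R \<union> ?T)"
  proof (rule AR_closed_Un)
    have "R \<inter> ?T = closed_segment a b"
      using meet chord segments(3) by blast
    then show "AR (R \<inter> ?T)"
      by (simp add: convex_imp_AR)
  qed (use R T compact_imp_closed in auto)
  moreover have "\<forall>\<^sub>F y in nhds x. orient p q y \<ge> 0 \<longrightarrow> y \<in> R \<union> ?T"
    if "(p, q) \<in> ?E" "x \<in> open_segment p q" for p q x
  proof -
    have "\<forall>\<^sub>F y in nhds x. orient p q y \<ge> 0 \<longrightarrow> y \<in> ?T" if "(p, q) \<in> {(a, c), (c, b)}"
      using that \<open>x \<in> open_segment p q\<close> triangle_left_of_edge[OF ear]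
        triangle_left_of_edge[OF rot(1), unfolded rot(3)] by blast
    moreover have "\<forall>\<^sub>F y in nhds x. orient p q y \<ge> 0 \<longrightarrow> y \<in> R" if "(p, q) \<in> E"
      using left that \<open>x \<in> open_segment p q\<close> by blast
    ultimately show ?thesis
      using that(1) by (auto elim!: eventually_mono)
  qed
  moreover have "\<forall>\<^sub>F y in nhds v. y \<in> R \<union> ?T \<longleftrightarrow> y - v \<in> sector (x - v) (u - v)"
    if uv: "(u, v) \<in> ?E" and vx: "(v, x) \<in> ?E" for u v x
  proof -
    have nc: "(c, z) \<notin> E" "(z, c) \<notin> E" for z
      using vertices c by blast+
    have cr: "cross2 (q - p) (r - p) = orient p q r" for p q r
      by (simp add: orient_def)
    \<comment> \<open>the corners at \<open>a\<close>, at \<open>b\<close>, at the new vertex, and the old ones elsewhere\<close>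
    consider "(v, x) = (a, c)" "(u, a) \<in> E" | "(u, v) = (c, b)" "(b, x) \<in> E"
      | "u = a" "v = c" "x = b" | "(u, v) \<in> E" "(v, x) \<in> E" "v \<noteq> a" "v \<noteq> b"
    proof -
      have "v \<noteq> a" if "(v, x) \<in> E - {(a, b)}"
        using that ab single_valuedD[OF sv(1), of a b x] by auto
      moreover have "v \<noteq> b" if "(u, v) \<in> E - {(a, b)}"
        using that ab single_valuedD[OF sv(2), of b a u] by auto
      ultimately show ?thesis
        using that uv vx nc(1)[of x] nc(2)[of u] ne by auto
    qed
    then show ?thesis
    proof cases
      case 1
      have "sector (c - a) (b - a) \<union> sector (b - a) (u - a) = sector (c - a) (u - a)"
        using at_a[OF 1(2)] rot(2) ear by (intro sector_add_left) (auto simp: cr orient_rotate)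
      then have "sector (b - a) (u - a) \<union> sector (c - a) (b - a) = sector (c - a) (u - a)"
        by blast
      then show ?thesis
        using eventually_mem_Un_sector[OF corner[OF 1(2) ab] triangle_corner[OF rot(2)]] 1(1)
        unfolding rot(4) by simp
    next
      case 2
      have "sector (x - b) (a - b) \<union> sector (a - b) (c - b) = sector (x - b) (c - b)"
        using at_b[OF 2(2)] rot(2) by (intro sector_add_right) (auto simp: cr orient_rotate)
      then show ?thesis
        using eventually_mem_Un_sector[OF corner[OF ab 2(2)] triangle_corner[OF rot(1)]] 2(1)
        unfolding rot(3) by simp
    next
      case 3
      have "\<forall>\<^sub>F y in nhds c. y \<notin> R"
        using c R(1) by (intro eventually_not_in_closed compact_imp_closed)
      with triangle_corner[OF ear] show ?thesis
        unfolding 3 by eventually_elim auto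
    next
      case 4
      have "v \<notin> ?T"
        using meet off_chord[OF 4(1,3,4)] vertices[OF 4(1)] by blast
      then have "\<forall>\<^sub>F y in nhds v. y \<notin> ?T"
        using T(1) by (intro eventually_not_in_closed compact_imp_closed)
      with corner[OF 4(1,2)] show ?thesis
        by eventually_elim auto
    qed
  qed
  moreover have "single_valued ?E" "single_valued (?E\<inverse>)"
  proof -
    have "(c, z) \<notin> E" "(z, c) \<notin> E" for z
      using vertices c by blast+
    note nc = this
    show "single_valued ?E"
    proof (rule single_valuedI)
      fix p q r assume "(p, q) \<in> ?E" "(p, r) \<in> ?E"
      then show "q = r"
        using nc(1)[of q] nc(1)[of r] single_valuedD[OF sv(1), of p q r]
          single_valuedD[OF sv(1) ab, of q] single_valuedD[OF sv(1) ab, of r] ne by auto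
    qed
    show "single_valued (?E\<inverse>)"
    proof (rule single_valuedI)
      fix p q r assume "(p, q) \<in> ?E\<inverse>" "(p, r) \<in> ?E\<inverse>"
      then show "q = r"
        using nc(2)[of q] nc(2)[of r] single_valuedD[OF sv(2), of p q r]
          single_valuedD[OF sv(2), of b a q] single_valuedD[OF sv(2), of b a r] ab ne by auto
    qed
  qed
  ultimately show ?thesis
    unfolding polygonal_disk_def using out fin R(1) T(1) by blast
qed

section \<open>Regions of planar faces in space\<close>

definition proj :: "real^3 \<Rightarrow> plane" where
  "proj p = (p $ 1, p $ 2)"

text \<open>The point above \<open>q\<close> in the plane \<open>n \<bullet> p = c\<close>, provided that plane is not vertical.\<close>

definition lift :: "real^3 \<Rightarrow> real \<Rightarrow> plane \<Rightarrow> real^3" where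
  "lift n c q = vector [fst q, snd q, (c - n $ 1 * fst q - n $ 2 * snd q) / n $ 3]"

lemma proj_lift [simp]: "proj (lift n c q) = q"
  by (simp add: proj_def lift_def)

lemma inner_3: "x \<bullet> y = x $ 1 * y $ 1 + x $ 2 * y $ 2 + x $ 3 * (y::real^3) $ 3"
  by (simp add: inner_vec_def sum_3)

lemma inner_lift: "n $ 3 \<noteq> 0 \<Longrightarrow> n \<bullet> lift n c q = c"
  by (simp add: inner_3 lift_def)

lemma lift_proj: "n $ 3 \<noteq> 0 \<Longrightarrow> n \<bullet> p = c \<Longrightarrow> lift n c (proj p) = p"
  by (auto simp: vec_eq_iff forall_3 lift_def proj_def inner_3 field_simps)

lemma inj_lift: "inj (lift n c)"
  by (rule inj_on_inverseI[of _ proj]) simp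

lemma linear_proj: "linear proj"
  by (rule linearI) (simp_all add: proj_def)

lemma continuous_on_proj [continuous_intros]: "continuous_on S proj"
  by (simp add: linear_proj linear_continuous_on linear_conv_bounded_linear[symmetric])

lemma continuous_on_lift [continuous_intros]: "continuous_on S (lift n c)"
proof -
  have "continuous_on S (\<lambda>q. \<chi> i. lift n c q $ i)"
  proof (rule continuous_on_vec_lambda)
    have "continuous_on S (\<lambda>q. lift n c q $ 1)" "continuous_on S (\<lambda>q. lift n c q $ 2)"
      "continuous_on S (\<lambda>q. lift n c q $ 3)"
      unfolding lift_def vector_3 divide_inverse by (intro continuous_intros)+
    then show "continuous_on S (\<lambda>q. lift n c q $ i)" for i
      using exhaust_3[of i] by auto
  qed
  then show ?thesis by (simp add: eta_contract_eq)
qed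

lemma lift_affine:
  assumes "u + v = 1"
  shows "lift n c (u *\<^sub>R a + v *\<^sub>R b) = u *\<^sub>R lift n c a + v *\<^sub>R lift n c b"
proof -
  have v: "v = 1 - u" using assms by simp
  show ?thesis
    unfolding v by (simp add: vec_eq_iff forall_3 lift_def add_divide_distrib diff_divide_distrib algebra_simps)
qed

lemma lift_segment: "lift n c ` closed_segment a b = closed_segment (lift n c a) (lift n c b)"
proof -
  have *: "lift n c ((1 - u) *\<^sub>R a + u *\<^sub>R b) = (1 - u) *\<^sub>R lift n c a + u *\<^sub>R lift n c b" for u
    by (rule lift_affine) simp
  show ?thesis
    by (force simp: closed_segment_def * )
qed

lemma lift_convex_hull_3:
  "lift n c ` (convex hull {p, q, r}) = convex hull {lift n c p, lift n c q, lift n c r}"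
proof -
  have *: "lift n c (u *\<^sub>R p + v *\<^sub>R q + w *\<^sub>R r) = u *\<^sub>R lift n c p + v *\<^sub>R lift n c q + w *\<^sub>R lift n c r"
    if "u + v + w = 1" for u v w
  proof -
    have u: "u = 1 - v - w" using that by simp
    show ?thesis
      unfolding u by (simp add: vec_eq_iff forall_3 lift_def add_divide_distrib diff_divide_distrib algebra_simps)
  qed
  show ?thesis
    unfolding convex_hull_3 by (force simp: * image_iff)
qed

text \<open>Barycentric coordinates in the shadow are affine coordinates in the plane above it.\<close>

lemma affine_hull_lift:
  assumes n: "n $ 3 \<noteq> 0" and abc: "{a, b, c} \<subseteq> S" "orient a b c \<noteq> 0"
  shows "affine hull (lift n d ` S) = {p. n \<bullet> p = d}"
proof
  show "affine hull (lift n d ` S) \<subseteq> {p. n \<bullet> p = d}"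
    by (rule hull_minimal) (auto simp: inner_lift[OF n] affine_hyperplane)
  show "{p. n \<bullet> p = d} \<subseteq> affine hull (lift n d ` S)"
  proof
    fix p assume p: "p \<in> {p. n \<bullet> p = d}"
    define q where "q = proj p"
    have pq: "p = lift n d q"
      using p by (simp add: q_def lift_proj[OF n])
    have "q \<in> affine hull {a, b, c}"
      unfolding affine_hull_3 using barycentric[of a b c q] abc(2) by blast
    then obtain u v w where q: "q = u *\<^sub>R a + v *\<^sub>R b + w *\<^sub>R c" "u + v + w = 1"
      by (auto simp: affine_hull_3)
    have u: "u = 1 - v - w" using q(2) by simp
    have "p = u *\<^sub>R lift n d a + v *\<^sub>R lift n d b + w *\<^sub>R lift n d c"
      unfolding pq q(1) u by (simp add: vec_eq_iff forall_3 lift_def add_divide_distrib diff_divide_distrib algebra_simps)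
    then have "p \<in> affine hull {lift n d a, lift n d b, lift n d c}"
      unfolding affine_hull_3 using q(2) by blast
    then show "p \<in> affine hull (lift n d ` S)"
      using hull_mono[of "{lift n d a, lift n d b, lift n d c}" "lift n d ` S" affine] abc(1) by blast
  qed
qed

lemma connected_subset_of_open_part:
  assumes "connected S" "open A" "open B" "S \<subseteq> A \<union> B" "A \<inter> B = {}" "x \<in> S" "x \<in> A"
  shows "S \<subseteq> A"
proof -
  have "A \<inter> S = {} \<or> B \<inter> S = {}"
    using assms by (intro connectedD) auto
  then show ?thesis using assms by blast
qed

text \<open>A component of the plane minus the polygon that meets the lifted region is trapped in it, since the region
is open and closed off the outline, and so it is bounded. Every other component contains the
whole complement of the region, which is connected because the region is a compact absolute retract, and so it is
unbounded.\<close>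

lemma face_region_lift:
  assumes n: "n $ 3 \<noteq> 0" and disk: "polygonal_disk E R"
    and outline: "polygon w = lift n c ` outline E"
    and hull: "affine hull set w = {p. n \<bullet> p = c}"
  shows "face_region w = lift n c ` R"
proof -
  have R: "compact R" "AR R" "outline E \<subseteq> R" "open (R - outline E)"
    using disk unfolding polygonal_disk_def by blast+
  define H where "H = {p. n \<bullet> p = c}"
  define C where "C x = connected_component_set (H - polygon w) x" for x
  have H: "lift n c (proj x) = x" if "x \<in> H" for x
    using that by (simp add: H_def lift_proj[OF n])
  have in_H: "lift n c q \<in> H" for q
    by (simp add: H_def inner_lift[OF n])
  have off: "proj x \<notin> outline E" if "x \<in> H - polygon w" for x
    using that H outline by (metis Diff_iff imageI)
  have on: "lift n c q \<in> H - polygon w" if "q \<notin> outline E" for q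
    using that in_H inj_lift[of n c] by (auto simp: outline inj_image_mem_iff)
  have CH: "C x \<subseteq> H - polygon w" for x
    by (simp add: C_def connected_component_subset)
  have inside: "bounded (C x)" if x: "x \<in> H - polygon w" "proj x \<in> R" for x
  proof -
    have sub: "proj ` C x \<subseteq> R - outline E"
    proof (rule connected_subset_of_open_part)
      show "connected (proj ` C x)"
        unfolding C_def by (intro connected_continuous_image continuous_on_proj connected_connected_component)
      show "open (- R)"
        using R(1) by (simp add: compact_imp_closed open_Compl)
      show "proj ` C x \<subseteq> (R - outline E) \<union> - R"
        using CH[of x] off by blast
      have "x \<in> C x"
        using x(1) by (simp add: C_def)
      then show "proj x \<in> proj ` C x" by (rule imageI)
      show "proj x \<in> R - outline E"
        using x off by simp
    qed (use R(4) in auto)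
    have "C x \<subseteq> lift n c ` R"
    proof
      fix y assume y: "y \<in> C x"
      then have "lift n c (proj y) = y" "proj y \<in> R"
        using H CH[of x] sub by blast+
      then show "y \<in> lift n c ` R" by (metis imageI)
    qed
    moreover have "compact (lift n c ` R)"
      by (intro compact_continuous_image continuous_on_lift R(1))
    ultimately show ?thesis
      by (meson bounded_subset compact_imp_bounded)
  qed
  have outside: "\<not> bounded (C x)" if x: "x \<in> H - polygon w" "proj x \<notin> R" for x
  proof
    assume b: "bounded (C x)"
    have "connected (- R)"
      by (rule connected_complement_absolute_retract) (use R in auto)
    then have "connected (lift n c ` (- R))"
      by (intro connected_continuous_image continuous_on_lift)
    moreover have "x \<in> lift n c ` (- R)"
      using x H[of x] by (metis ComplI DiffD1 image_eqI)
    moreover have "lift n c ` (- R) \<subseteq> H - polygon w"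
      using on R(3) by blast
    ultimately have "lift n c ` (- R) \<subseteq> C x"
      unfolding C_def by (intro connected_component_maximal)
    then have "bounded (proj ` lift n c ` (- R))"
      using b by (meson bounded_linear_image bounded_subset linear_conv_bounded_linear linear_proj)
    then have "bounded (- R)"
      by (simp add: image_image)
    then have "bounded (R \<union> - R)"
      using R(1) by (intro bounded_Un[THEN iffD2]) (simp add: compact_imp_bounded)
    then show False
      using not_bounded_UNIV[where 'a = plane] by simp
  qed
  have "face_region w = polygon w \<union> {x \<in> H - polygon w. proj x \<in> R}"
    using inside outside unfolding face_region_def hull H_def[symmetric] C_def by blast
  also have "\<dots> = lift n c ` R"
  proof -
    have "x \<in> lift n c ` R" if "x \<in> H" "proj x \<in> R" for x
      using H[OF that(1)] that(2) by (metis image_eqI)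
    moreover have "lift n c q \<in> H" "proj (lift n c q) = q" for q
      using in_H by simp_all
    ultimately show ?thesis
      using R(3) by (auto simp: outline)
  qed
  finally show ?thesis .
qed

section \<open>The shape of a face at a vertex\<close>

text \<open>Coordinates along the two edge directions make the description independent of the orientation of the face:
a reflex corner is the part of the plane where the coordinates are not both positive.\<close>

definition space_corner :: "real^3 \<Rightarrow> real^3 \<Rightarrow> bool \<Rightarrow> (real^3) set" where
  "space_corner a b conv = {\<alpha> *\<^sub>R a + \<beta> *\<^sub>R b | \<alpha> \<beta>.
     if conv then \<alpha> \<ge> 0 \<and> \<beta> \<ge> 0 else \<not> (\<alpha> > 0 \<and> \<beta> > 0)}"

lemma space_corner_commute: "space_corner a b conv = space_corner b a conv"
  unfolding space_corner_def by (rule Collect_cong) (metis add.commute)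

lemma sector_coefficients:
  assumes "cross2 a b \<noteq> 0"
  shows "y \<in> sector a b \<longleftrightarrow>
    (\<exists>\<alpha> \<beta>. y = \<alpha> *\<^sub>R a + \<beta> *\<^sub>R b \<and> (if cross2 a b > 0 then \<alpha> \<ge> 0 \<and> \<beta> \<ge> 0 else \<not> (\<alpha> > 0 \<and> \<beta> > 0)))"
    (is "?L \<longleftrightarrow> (\<exists>\<alpha> \<beta>. ?eq \<alpha> \<beta> \<and> ?C \<alpha> \<beta>)")
proof -
  define D where "D = cross2 a b"
  have D: "D \<noteq> 0" using assms by (simp add: D_def)
  have eq: "?eq (cross2 y b / D) (cross2 a y / D)"
  proof -
    have "D *\<^sub>R y = cross2 y b *\<^sub>R a + cross2 a y *\<^sub>R b"
      by (simp add: D_def cross2_def prod_eq_iff algebra_simps)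
    then have "(1 / D) *\<^sub>R (D *\<^sub>R y) = (1 / D) *\<^sub>R (cross2 y b *\<^sub>R a + cross2 a y *\<^sub>R b)"
      by simp
    then show ?thesis
      using D by (simp add: scaleR_right_distrib)
  qed
  have uniq: "cross2 y b = \<alpha> * D \<and> cross2 a y = \<beta> * D" if "?eq \<alpha> \<beta>" for \<alpha> \<beta>
    unfolding that D_def by (simp add: cross2_def algebra_simps)
  have sign: "?L \<longleftrightarrow> ?C \<alpha> \<beta>" if "?eq \<alpha> \<beta>" for \<alpha> \<beta>
  proof (cases "D > 0")
    case True
    then show ?thesis
      using uniq[OF that] by (simp add: sector_def D_def[symmetric] zero_le_mult_iff conj_commute)
  next
    case False
    then have "D < 0" using D by simp
    then show ?thesis
      using uniq[OF that] by (auto simp: sector_def D_def[symmetric] zero_le_mult_iff)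
  qed
  show ?thesis
    using eq sign by blast
qed

lemma lift_combination: "lift n c (v + \<alpha> *\<^sub>R (a - v) + \<beta> *\<^sub>R (b - v)) - lift n c v
    = \<alpha> *\<^sub>R (lift n c a - lift n c v) + \<beta> *\<^sub>R (lift n c b - lift n c v)"
  by (simp add: vec_eq_iff forall_3 lift_def add_divide_distrib diff_divide_distrib algebra_simps)

text \<open>Near a vertex membership in the region is membership in a sector, and coordinates along the two edges
turn the sector into a corner.\<close>

lemma polygonal_disk_corner:
  assumes n: "n $ 3 \<noteq> 0" and disk: "polygonal_disk E R" and E: "(u, v) \<in> E" "(v, x) \<in> E"
    and ne: "orient u v x \<noteq> 0"
  shows "\<forall>\<^sub>F y in nhds (lift n c v). y \<in> lift n c ` R \<longleftrightarrow>
      y - lift n c v \<in> space_corner (lift n c u - lift n c v) (lift n c x - lift n c v) (orient u v x > 0)"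
proof -
  have "\<forall>\<^sub>F y in nhds v. y \<in> R \<longleftrightarrow> y - v \<in> sector (x - v) (u - v)"
    using disk E unfolding polygonal_disk_def by blast
  moreover have "filterlim proj (nhds v) (nhds (lift n c v))"
  proof -
    have "proj \<midarrow>lift n c v\<rightarrow> proj (lift n c v)"
      using continuous_on_proj[of UNIV] unfolding continuous_on_def by blast
    then show ?thesis
      unfolding tendsto_at_iff_tendsto_nhds by simp
  qed
  ultimately have "\<forall>\<^sub>F y in nhds (lift n c v). proj y \<in> R \<longleftrightarrow> proj y - v \<in> sector (x - v) (u - v)"
    by (rule eventually_compose_filterlim)
  then show ?thesis
  proof eventually_elim
    case (elim y)
    have D: "cross2 (x - v) (u - v) = orient u v x"
      by (simp add: orient_def cross2_def algebra_simps)
    have *: "y - lift n c v \<in> space_corner (lift n c u - lift n c v) (lift n c x - lift n c v) (orient u v x > 0)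
      \<longleftrightarrow> (\<exists>\<alpha> \<beta>. y = lift n c (v + \<alpha> *\<^sub>R (x - v) + \<beta> *\<^sub>R (u - v)) \<and>
            (if orient u v x > 0 then \<alpha> \<ge> 0 \<and> \<beta> \<ge> 0 else \<not> (\<alpha> > 0 \<and> \<beta> > 0)))"
    proof -
      have "y = lift n c (v + \<alpha> *\<^sub>R (x - v) + \<beta> *\<^sub>R (u - v)) \<longleftrightarrow>
        y - lift n c v = \<alpha> *\<^sub>R (lift n c x - lift n c v) + \<beta> *\<^sub>R (lift n c u - lift n c v)" for \<alpha> \<beta>
        unfolding lift_combination[symmetric] by simp
      then show ?thesis
        by (subst space_corner_commute) (simp only: space_corner_def mem_Collect_eq)
    qed
    show ?case
    proof (cases "n \<bullet> y = c")
      case True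
      then have y: "lift n c (proj y) = y" by (rule lift_proj[OF n])
      have "y \<in> lift n c ` R \<longleftrightarrow> proj y \<in> R"
        using y by (metis image_iff proj_lift)
      also have "\<dots> \<longleftrightarrow> (\<exists>\<alpha> \<beta>. proj y - v = \<alpha> *\<^sub>R (x - v) + \<beta> *\<^sub>R (u - v) \<and>
            (if orient u v x > 0 then \<alpha> \<ge> 0 \<and> \<beta> \<ge> 0 else \<not> (\<alpha> > 0 \<and> \<beta> > 0)))"
        using elim sector_coefficients[of "x - v" "u - v" "proj y - v"] ne D by simp
      also have "\<dots> \<longleftrightarrow> (\<exists>\<alpha> \<beta>. y = lift n c (v + \<alpha> *\<^sub>R (x - v) + \<beta> *\<^sub>R (u - v)) \<and>
            (if orient u v x > 0 then \<alpha> \<ge> 0 \<and> \<beta> \<ge> 0 else \<not> (\<alpha> > 0 \<and> \<beta> > 0)))"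
      proof -
        have "proj y - v = z \<longleftrightarrow> y = lift n c (v + z)" for z
          using y by (metis add_diff_cancel_left' diff_add_cancel add.commute proj_lift)
        then show ?thesis by (simp add: add.assoc)
      qed
      finally show ?thesis unfolding * .
    next
      case False
      then show ?thesis
        unfolding * by (auto simp: inner_lift[OF n])
    qed
  qed
qed

section \<open>Disk neighborhoods of vertices of degree three\<close>

text \<open>The first two corners, between the axes 1, 2 and 2, 3, are convex. If the third is convex too, the three corners
form the boundary of the octant, the zero set of the minimum. If it is reflex, the coordinate \<open>t\<^sub>2\<close> vanishes on it
where \<open>min t\<^sub>1 t\<^sub>3 \<le> 0\<close>, and on the convex corners \<open>min t\<^sub>1 t\<^sub>3 = 0\<close> where \<open>t\<^sub>2 \<ge> 0\<close>.\<close>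

definition corner_height :: "bool \<Rightarrow> real^3 \<Rightarrow> real" where
  "corner_height conv t =
     (if conv then min (t $ 1) (min (t $ 2) (t $ 3)) else max (- t $ 2) (min (t $ 1) (t $ 3)))"

definition corner_axis :: "bool \<Rightarrow> real^3" where
  "corner_axis conv = vector [1, if conv then 1 else - 1, 1]"

text \<open>Unit growth along the axis: every line in that direction meets each level set exactly once.\<close>

lemma corner_height_shift: "corner_height conv (t + s *\<^sub>R corner_axis conv) = corner_height conv t + s"
  by (auto simp: corner_height_def corner_axis_def min_def max_def)

definition frame_map :: "real^3 \<Rightarrow> real^3 \<Rightarrow> real^3 \<Rightarrow> real^3 \<Rightarrow> real^3" where
  "frame_map a b c t = t $ 1 *\<^sub>R a + t $ 2 *\<^sub>R b + t $ 3 *\<^sub>R c"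

lemma linear_frame_map: "linear (frame_map a b c)"
  by (rule linearI) (simp_all add: frame_map_def algebra_simps)

lemma corners_as_level_set:
  "space_corner a b True \<union> space_corner b c True \<union> space_corner c a conv
     = frame_map a b c ` {t. corner_height conv t = 0}" (is "?L = ?R")
proof
  have *: "x *\<^sub>R a + y *\<^sub>R b + z *\<^sub>R c \<in> ?R"
    if "corner_height conv (vector [x, y, z]) = 0" for x y z
    using that by (intro image_eqI[of _ _ "vector [x, y, z]"]) (simp_all add: frame_map_def)
  show "?L \<subseteq> ?R"
  proof
    fix p assume "p \<in> ?L"
    then consider \<alpha> \<beta> where "p = \<alpha> *\<^sub>R a + \<beta> *\<^sub>R b" "\<alpha> \<ge> 0" "\<beta> \<ge> 0"
      | \<alpha> \<beta> where "p = \<alpha> *\<^sub>R b + \<beta> *\<^sub>R c" "\<alpha> \<ge> 0" "\<beta> \<ge> 0"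
      | \<alpha> \<beta> where "p = \<alpha> *\<^sub>R c + \<beta> *\<^sub>R a" "if conv then \<alpha> \<ge> 0 \<and> \<beta> \<ge> 0 else \<not> (\<alpha> > 0 \<and> \<beta> > 0)"
      by (auto simp: space_corner_def)
    then show "p \<in> ?R"
    proof cases
      case (1 \<alpha> \<beta>)
      then show ?thesis using *[of \<alpha> \<beta> 0] by (auto simp: corner_height_def)
    next
      case (2 \<alpha> \<beta>)
      then show ?thesis using *[of 0 \<alpha> \<beta>] by (auto simp: corner_height_def)
    next
      case (3 \<alpha> \<beta>)
      have "corner_height conv (vector [\<beta>, 0, \<alpha>]) = 0"
        using 3(2) by (auto simp: corner_height_def min_def max_def split: if_splits)
      then show ?thesis using *[of \<beta> 0 \<alpha>] 3(1) by (simp add: add.commute)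
    qed
  qed
  show "?R \<subseteq> ?L"
  proof
    fix p assume "p \<in> ?R"
    then obtain t where t: "p = frame_map a b c t" "corner_height conv t = 0" by blast
    define x y z where "x = t $ 1" "y = t $ 2" "z = t $ 3"
    then have p: "p = x *\<^sub>R a + y *\<^sub>R b + z *\<^sub>R c"
      and h: "if conv then min x (min y z) = 0 else max (- y) (min x z) = 0"
      using t by (simp_all add: frame_map_def corner_height_def split: if_splits)
    have A: "p \<in> space_corner a b True" if "z = 0" "x \<ge> 0" "y \<ge> 0"
      unfolding space_corner_def mem_Collect_eq by (intro exI[of _ x] exI[of _ y]) (use that p in auto)
    have B: "p \<in> space_corner b c True" if "x = 0" "y \<ge> 0" "z \<ge> 0"
      unfolding space_corner_def mem_Collect_eq by (intro exI[of _ y] exI[of _ z]) (use that p in auto)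
    have C: "p \<in> space_corner c a conv" if "y = 0" "if conv then z \<ge> 0 \<and> x \<ge> 0 else \<not> (z > 0 \<and> x > 0)"
      unfolding space_corner_def mem_Collect_eq by (intro exI[of _ z] exI[of _ x]) (use that p in auto)
    have "(z = 0 \<and> x \<ge> 0 \<and> y \<ge> 0) \<or> (x = 0 \<and> y \<ge> 0 \<and> z \<ge> 0) \<or>
        (y = 0 \<and> (if conv then z \<ge> 0 \<and> x \<ge> 0 else \<not> (z > 0 \<and> x > 0)))"
      using h by (auto simp: min_def max_def split: if_splits)
    then show "p \<in> ?L" using A B C by blast
  qed
qed

text \<open>Sliding along the axis maps the coordinate plane \<open>t\<^sub>2 = 0\<close> homeomorphically onto the zero set of
\<^term>\<open>corner_height conv\<close>. A small disk of that plane is thus carried onto a neighborhood of the vertex.\<close>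

lemma disk_at_vertex:
  assumes indep: "inj (frame_map a b c)"
    and S: "\<forall>\<^sub>F y in nhds v. y \<in> S \<longleftrightarrow>
      y - v \<in> space_corner a b True \<union> space_corner b c True \<union> space_corner c a conv"
  shows "\<exists>U. openin (top_of_set S) U \<and> v \<in> U \<and> U homeomorphic ball (0::real^2) 1"
proof -
  define f where "f = corner_height conv"
  define p where "p = corner_axis conv"
  define D where "D = frame_map a b c"
  have linD: "linear D" by (simp add: D_def linear_frame_map)
  obtain D' where linD': "linear D'" and D': "\<And>t. D' (D t) = t"
    using linear_injective_left_inverse[OF linD] indep by (auto simp: D_def fun_eq_iff)
  obtain N where N: "open N" "v \<in> N" "\<And>y. y \<in> N \<Longrightarrow> y \<in> S \<longleftrightarrow> y - v \<in> D ` {t. f t = 0}"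
    using S unfolding corners_as_level_set eventually_nhds f_def D_def by blast
  define base :: "real^2 \<Rightarrow> real^3" where "base q = vector [q $ 1, 0, q $ 2]" for q
  define \<sigma> :: real where "\<sigma> = (if conv then 1 else - 1)"
  define g where "g q = v + D (base q - f (base q) *\<^sub>R p)" for q
  \<comment> \<open>the projection along the axis to the plane \<open>t\<^sub>2 = 0\<close>\<close>
  define h :: "real^3 \<Rightarrow> real^2" where
    "h y = (let t = D' (y - v) in vector [t $ 1 - \<sigma> * t $ 2, t $ 3 - \<sigma> * t $ 2])" for y
  have shift: "f (t + s *\<^sub>R p) = f t + s" for t s
    by (simp add: f_def p_def corner_height_shift)
  have \<sigma>: "\<sigma> * \<sigma> = 1" and p: "p $ 1 = 1" "p $ 2 = \<sigma>" "p $ 3 = 1"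
    by (auto simp: \<sigma>_def p_def corner_axis_def)
  have level: "f (base q - f (base q) *\<^sub>R p) = 0" for q
    using shift[of "base q" "- f (base q)"] by simp
  have hg: "h (g q) = q" for q
    using \<sigma> by (simp add: h_def g_def D' Let_def base_def p vec_eq_iff forall_2 algebra_simps)
  have gh: "g (h (v + D t)) = v + D t" if "f t = 0" for t
  proof -
    have "base (h (v + D t)) = t + (- \<sigma> * t $ 2) *\<^sub>R p"
      using \<sigma> by (simp add: h_def D' Let_def base_def p vec_eq_iff forall_3 algebra_simps)
    moreover from this have "f (base (h (v + D t))) = - \<sigma> * t $ 2"
      using shift[of t "- \<sigma> * t $ 2"] that by simp
    ultimately show ?thesis
      by (simp add: g_def)
  qed
  have cont_D: "continuous_on A D" and cont_D': "continuous_on A D'" for A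
    using linD linD' by (simp_all add: linear_continuous_on linear_conv_bounded_linear[symmetric])
  have vec3: "continuous_on A (\<lambda>q. vector [F q, G q, H q] :: real^3)"
    if "continuous_on A F" "continuous_on A G" "continuous_on A H" for A and F G H :: "real^2 \<Rightarrow> real"
  proof -
    have "continuous_on A (\<lambda>q. \<chi> i. (vector [F q, G q, H q] :: real^3) $ i)"
    proof (rule continuous_on_vec_lambda)
      show "continuous_on A (\<lambda>q. (vector [F q, G q, H q] :: real^3) $ i)" for i
        using exhaust_3[of i] that by auto
    qed
    then show ?thesis by simp
  qed
  have cont_base: "continuous_on A base" for A
    unfolding base_def by (intro vec3 continuous_intros)
  have cont_f: "continuous_on A f" for A
    unfolding f_def corner_height_def by (cases conv) (auto intro!: continuous_intros)
  have cont_g: "continuous_on A g" for A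
    unfolding g_def
    by (intro continuous_intros continuous_on_compose2[OF cont_D[of UNIV]]
        continuous_on_compose2[OF cont_f[of UNIV]] cont_base) auto
  have cont_h: "continuous_on A h" for A
  proof -
    have "continuous_on A (\<lambda>y. \<chi> i. h y $ i)"
    proof (rule continuous_on_vec_lambda)
      have "continuous_on A (\<lambda>y. h y $ 1)" "continuous_on A (\<lambda>y. h y $ 2)"
        unfolding h_def Let_def vector_2
        by (intro continuous_intros continuous_on_compose2[OF cont_D'[of UNIV]]; auto)+
      then show "continuous_on A (\<lambda>y. h y $ i)" for i
        using exhaust_2[of i] by auto
    qed
    then show ?thesis by simp
  qed
  have g0: "g 0 = v"
  proof -
    have "base 0 = 0" by (simp add: base_def vec_eq_iff forall_3)
    moreover have "f 0 = 0" by (simp add: f_def corner_height_def)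
    ultimately show ?thesis by (simp add: g_def linear_0[OF linD])
  qed
  have "open (g -` N)"
    using open_vimage[OF N(1) cont_g] .
  moreover have "0 \<in> g -` N" using g0 N(2) by simp
  ultimately obtain \<epsilon> where \<epsilon>: "\<epsilon> > 0" "ball 0 \<epsilon> \<subseteq> g -` N"
    by (meson openE)
  define U where "U = g ` ball 0 \<epsilon>"
  have "U = S \<inter> (N \<inter> h -` ball 0 \<epsilon>)"
  proof
    show "U \<subseteq> S \<inter> (N \<inter> h -` ball 0 \<epsilon>)"
    proof
      fix y assume "y \<in> U"
      then obtain q where q: "q \<in> ball 0 \<epsilon>" "y = g q" by (auto simp: U_def)
      then have "y \<in> N" using \<epsilon>(2) by auto
      moreover have "y - v \<in> D ` {t. f t = 0}"
        using level[of q] by (auto simp: q(2) g_def)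
      ultimately show "y \<in> S \<inter> (N \<inter> h -` ball 0 \<epsilon>)"
        using N(3) q hg by auto
    qed
    show "S \<inter> (N \<inter> h -` ball 0 \<epsilon>) \<subseteq> U"
    proof
      fix y assume y: "y \<in> S \<inter> (N \<inter> h -` ball 0 \<epsilon>)"
      then obtain t where "f t = 0" "y - v = D t" using N(3) by auto
      then have "y = v + D t" "f t = 0" by (simp_all add: algebra_simps)
      then have "y = g (h y)" using gh by simp
      then show "y \<in> U" using y by (auto simp: U_def)
    qed
  qed
  moreover have "open (N \<inter> h -` ball 0 \<epsilon>)"
    by (intro open_Int N(1) open_vimage cont_h open_ball)
  ultimately have "openin (top_of_set S) U"
    unfolding openin_open by blast
  moreover have "v \<in> U"
    using g0 \<epsilon>(1) unfolding U_def by (metis centre_in_ball imageI)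
  moreover have "U homeomorphic ball (0::real^2) 1"
  proof -
    have "ball (0::real^2) \<epsilon> homeomorphic U"
      unfolding homeomorphic_def homeomorphism_def U_def
      by (intro exI[of _ g] exI[of _ h]) (auto simp: hg image_image cont_g cont_h)
    moreover have "ball (0::real^2) \<epsilon> homeomorphic ball (0::real^2) 1"
      by (rule homeomorphic_balls) (use \<epsilon> in auto)
    ultimately show ?thesis
      using homeomorphic_sym homeomorphic_trans by blast
  qed
  ultimately show ?thesis by blast
qed

section \<open>Integer data and finite checks\<close>

text \<open>The vertices once more with integer entries, so that statements about them can be evaluated.\<close>

definition coords :: "(int \<times> int \<times> int) list" where
  "coords = [
     (-72, 84, 18), (-36, 112, 102), (72, -84, 18), (36, -112, 102),
     (0, 300, 234), (-84, 48, -18), (9, 147, 207), (0, -300, 234),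
     (84, -48, -18), (-112, -36, -102), (48, 84, 18), (-147, 9, -207),
     (-9, -147, 207), (84, 72, -18), (112, 36, -102), (-48, -84, 18),
     (147, -9, -207), (-18, 126, 144), (-126, -18, -144), (-300, 0, -234),
     (-84, -72, -18), (18, -126, 144), (126, 18, -144), (300, 0, -234)]"

definition coord :: "nat \<Rightarrow> int \<times> int \<times> int" where
  "coord i = coords ! (i - 1)"

definition shadow :: "nat \<Rightarrow> int \<times> int" where
  "shadow i = (fst (coord i), fst (snd (coord i)))"

definition face_idx :: "nat \<Rightarrow> nat list" where
  "face_idx k = [
     [6, 10, 16, 22, 18, 7, 5, 1, 2],
     [9, 15, 11, 18, 22, 13, 8, 3, 4],
     [7, 5, 8, 3, 17, 23, 9, 15, 14],
     [13, 8, 5, 1, 12, 19, 6, 10, 21],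
     [1, 2, 11, 18, 7, 14, 24, 20, 12],
     [3, 4, 16, 22, 13, 21, 20, 24, 17],
     [14, 24, 17, 23, 19, 6, 2, 11, 15],
     [10, 21, 20, 12, 19, 23, 9, 4, 16]] ! (k - 1)"

definition face_edges :: "nat \<Rightarrow> (nat \<times> nat) list" where
  "face_edges k = zip (face_idx k) (rotate1 (face_idx k))"

text \<open>In the shadow the walks of the faces 1 to 4 run counterclockwise and the others clockwise.\<close>

definition ccw_edges :: "nat \<Rightarrow> (nat \<times> nat) list" where
  "ccw_edges k = (if k \<le> 4 then face_edges k else map prod.swap (face_edges k))"

text \<open>The quadruple \<open>(p, q, r, c)\<close> stands for the plane \<open>p * x + q * y + r * z = c\<close>.\<close>

definition face_plane :: "nat \<Rightarrow> int \<times> int \<times> int \<times> int" where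
  "face_plane k = [(-21, -3, 10, 1440), (21, 3, 10, 1440), (3, 0, 1, 234), (-3, 0, 1, 234), (0, -3, 1, -234), (0, 3, 1, -234), (3, -21, 10, -1440), (-3, 21, 10, -1440)] ! (k - 1)"

text \<open>Triangulations of the shadows in reverse order of growth. A triangle \<open>(a, c, b)\<close> is attached along the edge
from \<open>a\<close> to \<open>b\<close> of the union of the triangles after it, with the new vertex \<open>c\<close>.\<close>

definition ears :: "nat \<Rightarrow> (nat \<times> nat \<times> nat) list" where
  "ears k = [
     [(5, 1, 2), (18, 7, 5), (18, 5, 2), (22, 18, 2), (16, 22, 2), (10, 16, 2), (6, 10, 2)],
      [(8, 3, 4), (22, 13, 8), (22, 8, 4), (18, 22, 4), (11, 18, 4), (15, 11, 4), (9, 15, 4)],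
      [(9, 15, 14), (7, 5, 8), (14, 7, 8), (14, 8, 3), (9, 14, 3), (17, 23, 9), (3, 17, 9)],
      [(6, 10, 21), (13, 8, 5), (21, 13, 5), (21, 5, 1), (6, 21, 1), (12, 19, 6), (1, 12, 6)],
      [(11, 2, 1), (12, 20, 24), (1, 12, 24), (1, 24, 14), (11, 1, 14), (7, 18, 11), (14, 7, 11)],
      [(16, 4, 3), (17, 24, 20), (3, 17, 20), (3, 20, 21), (16, 3, 21), (13, 22, 16), (21, 13, 16)],
      [(24, 14, 15), (23, 17, 24), (23, 24, 15), (6, 19, 23), (2, 6, 23), (11, 2, 23), (15, 11, 23)],
      [(20, 21, 10), (19, 12, 20), (19, 20, 10), (23, 19, 10), (9, 23, 10), (4, 9, 10), (16, 4, 10)]] ! (k - 1)"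

text \<open>Vertex lists of convex polygons obtained by merging triangles of the triangulations.\<close>

definition pieces :: "nat \<Rightarrow> nat list list" where
  "pieces k = [
     [[22, 18, 2, 6, 10, 16], [1, 2, 18, 7, 5]],
      [[15, 11, 18, 22, 4, 9], [13, 8, 3, 4, 22]],
      [[8, 7, 5], [15, 14, 7, 8, 3, 9], [23, 9, 3, 17]],
      [[13, 8, 5], [10, 21, 13, 5, 1, 6], [1, 12, 19, 6]],
      [[24, 12, 20], [1, 12, 24, 14, 11, 2], [14, 7, 18, 11]],
      [[24, 20, 17], [21, 16, 4, 3, 17, 20], [13, 22, 16, 21]],
      [[15, 11, 2, 6, 19, 23], [24, 14, 15, 23, 17]],
      [[9, 23, 19, 10, 16, 4], [21, 10, 19, 12, 20]]] ! (k - 1)"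

definition iorient :: "int \<times> int \<Rightarrow> int \<times> int \<Rightarrow> int \<times> int \<Rightarrow> int" where
  "iorient a b c = (fst b - fst a) * (snd c - snd a) - (snd b - snd a) * (fst c - fst a)"

text \<open>Some \<open>f\<close> among the candidates, an affine function restricted to the points, separates the convex hulls weakly.
The points of \<open>S\<close> or those of \<open>T\<close> on its zero set then span a polytope that contains the intersection of the hulls.\<close>

definition separates :: "('p \<Rightarrow> int) list \<Rightarrow> 'p list \<Rightarrow> 'p list \<Rightarrow> ('p list \<Rightarrow> bool) \<Rightarrow> bool" where
  "separates fs S T ok \<longleftrightarrow> (\<exists>f\<in>set fs. (\<forall>x\<in>set S. f x \<ge> 0) \<and> (\<forall>y\<in>set T. f y \<le> 0) \<and>
     (ok (filter (\<lambda>x. f x = 0) S) \<or> ok (filter (\<lambda>y. f y = 0) T)))"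

text \<open>Conditional expressions are evaluated lazily, so that the search stops at the first separating function.\<close>

lemma separates_code [code]:
  "separates [] S T ok = False"
  "separates (f # fs) S T ok =
     (if (if list_all (\<lambda>x. f x \<ge> 0) S then
            if list_all (\<lambda>y. f y \<le> 0) T then
              if ok (filter (\<lambda>x. f x = 0) S) then True else ok (filter (\<lambda>y. f y = 0) T)
            else False else False)
      then True else separates fs S T ok)"
  unfolding separates_def list_all_iff by auto

type_synonym triangle = "(int \<times> int) \<times> (int \<times> int) \<times> (int \<times> int)"

fun ear_edges :: "triangle list \<Rightarrow> ((int \<times> int) \<times> (int \<times> int)) list" where
  "ear_edges [] = []"
| "ear_edges ((a, c, b) # ts) =
     (if ts = [] then [(a, c), (c, b), (b, a)] else (a, c) # (c, b) # removeAll (a, b) (ear_edges ts))"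

definition lines :: "(int \<times> int) list \<Rightarrow> (int \<times> int \<Rightarrow> int) list" where
  "lines P = concat (map (\<lambda>p. map (iorient p) P) P)"

text \<open>The premises of \<open>polygonal_disk_add_ear\<close> for integer points. A vertex off the line through \<open>a\<close> and \<open>b\<close> is certainly
off the chord.\<close>

fun ears_ok :: "triangle list \<Rightarrow> bool" where
  "ears_ok [] = False"
| "ears_ok ((a, c, b) # ts) = (iorient a c b > 0 \<and> (ts = [] \<or> (ears_ok ts \<and>
     (a, b) \<in> set (ear_edges ts) \<and>
     (\<forall>(p, q, r)\<in>set ts. separates (lines [a, c, b] @ lines [p, q, r]) [a, c, b] [p, q, r]
        (\<lambda>Z. set Z \<subseteq> {a, b})) \<and>
     (\<forall>(u, v)\<in>set (ear_edges ts). (v = a \<longrightarrow> iorient a b u > 0 \<or> iorient a u c > 0) \<and>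
        (u = b \<longrightarrow> iorient b v a > 0 \<or> iorient b c v > 0) \<and>
        (v = a \<or> v = b \<or> iorient a b v \<noteq> 0)))))"

definition shadow_ears :: "nat \<Rightarrow> triangle list" where
  "shadow_ears k = map (\<lambda>(a, c, b). (shadow a, shadow c, shadow b)) (ears k)"

definition plane_value :: "int \<times> int \<times> int \<times> int \<Rightarrow> nat \<Rightarrow> int" where
  "plane_value = (\<lambda>(p, q, r, c) i. case coord i of (x, y, z) \<Rightarrow> p * x + q * y + r * z - c)"

lemma ears_ok_faces: "\<forall>k\<in>set [1..<9]. ears_ok (shadow_ears k)"
  by code_simp

lemma ears_outline: "\<forall>k\<in>set [1..<9].
   set (ear_edges (shadow_ears k)) = set (map (map_prod shadow shadow) (ccw_edges k))"
  by code_simp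

lemma face_planes: "\<forall>k\<in>set [1..<9]. \<forall>i\<in>set (face_idx k). plane_value (face_plane k) i = 0"
  by code_simp

definition common_edge_or_vertex :: "nat \<Rightarrow> nat \<Rightarrow> nat list \<Rightarrow> bool" where
  "common_edge_or_vertex k l Z \<longleftrightarrow> Z = [] \<or> (\<exists>i\<in>set (face_idx k) \<inter> set (face_idx l). Z = [i]) \<or>
     (\<exists>(i, j)\<in>set (face_edges k). ((i, j) \<in> set (face_edges l) \<or> (j, i) \<in> set (face_edges l)) \<and>
        (Z = [i, j] \<or> Z = [j, i]))"

text \<open>The two face planes separate most pairs of pieces; the auxiliary planes serve the others. The negated
quadruples allow the pieces to lie on either side.\<close>

definition separating_planes :: "nat \<Rightarrow> nat \<Rightarrow> (int \<times> int \<times> int \<times> int) list" where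
  "separating_planes k l = (let P = [face_plane k, face_plane l,
      (1, 0, 0, 0), (0, 1, 0, 0), (1, 0, 0, -36), (0, 1, 0, -84),
      (0, 0, 1, 207), (0, 0, 1, -207), (0, 0, 1, 102)] in
     P @ map (\<lambda>(p, q, r, c). (-p, -q, -r, -c)) P)"

lemma pieces_separated_check: "\<forall>k\<in>set [1..<9]. \<forall>l\<in>set [Suc k..<9]. \<forall>S\<in>set (pieces k). \<forall>T\<in>set (pieces l).
    separates (map plane_value (separating_planes k l)) S T (common_edge_or_vertex k l)"
  by code_simp

text \<open>The signed areas decide all pairs of edges that do not lie on a common line. Some faces have disjoint collinear
edges, never vertical in the shadow, and these are separated by their first coordinates.\<close>

definition side_functionals :: "nat \<Rightarrow> nat \<Rightarrow> (nat \<Rightarrow> int) list" where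
  "side_functionals i j =
     [\<lambda>x. iorient (shadow i) (shadow j) (shadow x), \<lambda>x. iorient (shadow j) (shadow i) (shadow x),
      \<lambda>x. fst (shadow x) - fst (shadow i), \<lambda>x. fst (shadow x) - fst (shadow j),
      \<lambda>x. fst (shadow i) - fst (shadow x), \<lambda>x. fst (shadow j) - fst (shadow x)]"

lemma sides_separated: "\<forall>k\<in>set [1..<9]. \<forall>i\<in>set [0..<9]. \<forall>j\<in>set [Suc i..<9].
   (let w = face_idx k; a = w ! i; b = w ! (Suc i mod 9); c = w ! j; d = w ! (Suc j mod 9) in
      separates (side_functionals a b @ side_functionals c d) [a, b] [c, d]
        (\<lambda>Z. set Z \<subseteq> set ((if j = Suc i mod 9 then [c] else []) @ (if i = Suc j mod 9 then [a] else []))))"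
  by code_simp

lemma face_idx_properties: "\<forall>k\<in>set [1..<9]. set (face_idx k) \<subseteq> set [1..<25] \<and> distinct (face_idx k) \<and>
   length (face_idx k) = 9"
  by code_simp

lemma face_plane_not_vertical: "\<forall>k\<in>set [1..<9]. fst (snd (snd (face_plane k))) \<noteq> 0"
  by code_simp

lemma ears_in_pieces: "\<forall>k\<in>set [1..<9]. (\<forall>(a, c, b)\<in>set (ears k). \<exists>P\<in>set (pieces k). set [a, c, b] \<subseteq> set P) \<and>
   (\<forall>P\<in>set (pieces k). set P \<subseteq> set (face_idx k))"
  by code_simp

section \<open>From finite checks to geometry\<close>

definition real_vec :: "int \<times> int \<times> int \<Rightarrow> real^3" where
  "real_vec = (\<lambda>(x, y, z). vector [of_int x, of_int y, of_int z])"

lemma vert_real_vec: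
  assumes "i \<in> {1..24}"
  shows "vert i = real_vec (coord i)"
proof -
  have eq: "vertex_list = map real_vec coords"
    by (simp add: vertex_list_def coords_def real_vec_def)
  show ?thesis
    unfolding vert_def coord_def eq by (rule nth_map) (use assms in \<open>auto simp: coords_def\<close>)
qed

definition real_pair :: "int \<times> int \<Rightarrow> plane" where
  "real_pair q = (of_int (fst q), of_int (snd q))"

lemma inj_real_pair: "inj real_pair"
  by (auto simp: inj_def real_pair_def)

lemma orient_real_pair: "orient (real_pair a) (real_pair b) (real_pair c) = of_int (iorient a b c)"
  by (simp add: orient_def cross2_def real_pair_def iorient_def)

text \<open>A supporting hyperplane cuts a polytope in a face, and a face is spanned by the given points it contains.\<close>

lemma convex_hull_Int_hyperplane:
  fixes S :: "'a::euclidean_space set"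
  assumes "finite S" "\<And>x. x \<in> S \<Longrightarrow> n \<bullet> x \<ge> c"
  shows "convex hull S \<inter> {x. n \<bullet> x = c} \<subseteq> convex hull {x \<in> S. n \<bullet> x = c}"
proof -
  have "convex hull S \<subseteq> {x. n \<bullet> x \<ge> c}"
    by (rule hull_minimal) (use assms(2) in \<open>auto simp: convex_halfspace_ge\<close>)
  then have "convex hull S \<inter> {x. n \<bullet> x = c} face_of convex hull S"
    by (intro face_of_Int_supporting_hyperplane_ge) auto
  then obtain S' where S': "S' \<subseteq> S" "convex hull S \<inter> {x. n \<bullet> x = c} = convex hull S'"
    using face_of_convex_hull_subset[of S] assms(1) by (metis finite_imp_compact)
  have "S' \<subseteq> {x \<in> S. n \<bullet> x = c}"
    using S' hull_subset[of S' convex] by blast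
  then show ?thesis
    using S'(2) hull_mono by blast
qed

lemma separates_imp_Int_convex_hull:
  fixes e :: "'p \<Rightarrow> 'a::euclidean_space"
  assumes sep: "separates fs S T ok"
    and affine: "\<And>f. f \<in> set fs \<Longrightarrow> \<exists>n c. \<forall>x\<in>set S \<union> set T. n \<bullet> e x - c = of_int (f x)"
  obtains Z where "ok Z" "convex hull (e ` set S) \<inter> convex hull (e ` set T) \<subseteq> convex hull (e ` set Z)"
proof -
  obtain f where f: "f \<in> set fs" "\<forall>x\<in>set S. f x \<ge> 0" "\<forall>y\<in>set T. f y \<le> 0"
    "ok (filter (\<lambda>x. f x = 0) S) \<or> ok (filter (\<lambda>y. f y = 0) T)"
    using sep by (auto simp: separates_def)
  obtain n c where nc: "\<forall>x\<in>set S \<union> set T. n \<bullet> e x - c = of_int (f x)"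
    using affine[OF f(1)] by blast
  have S: "n \<bullet> e x \<ge> c" "n \<bullet> e x = c \<longleftrightarrow> f x = 0" if "x \<in> set S" for x
    using nc f(2) that by (smt (verit) UnI1 of_int_0_le_iff, smt (verit) UnI1 of_int_eq_0_iff)
  have T: "(- n) \<bullet> e x \<ge> - c" "(- n) \<bullet> e x = - c \<longleftrightarrow> f x = 0" if "x \<in> set T" for x
    using nc f(3) that
    by (simp_all, smt (verit) UnI2 of_int_le_0_iff, smt (verit) UnI2 of_int_eq_0_iff)
  have common: "convex hull (e ` set S) \<inter> convex hull (e ` set T) \<subseteq> {x. n \<bullet> x = c}"
  proof -
    have "convex hull (e ` set S) \<subseteq> {x. n \<bullet> x \<ge> c}"
      by (rule hull_minimal) (use S in \<open>auto simp: convex_halfspace_ge\<close>)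
    moreover have "convex hull (e ` set T) \<subseteq> {x. n \<bullet> x \<le> c}"
      by (rule hull_minimal) (use T in \<open>auto simp: convex_halfspace_le\<close>)
    ultimately show ?thesis by force
  qed
  have on_S: "convex hull (e ` set S) \<inter> {x. n \<bullet> x = c} \<subseteq> convex hull (e ` set (filter (\<lambda>x. f x = 0) S))"
  proof -
    have "{x \<in> e ` set S. n \<bullet> x = c} = e ` set (filter (\<lambda>x. f x = 0) S)"
      using S(2) by auto
    then show ?thesis
      using convex_hull_Int_hyperplane[of "e ` set S" c n] S(1) by fastforce
  qed
  have on_T: "convex hull (e ` set T) \<inter> {x. n \<bullet> x = c} \<subseteq> convex hull (e ` set (filter (\<lambda>x. f x = 0) T))"
  proof -
    have "{x \<in> e ` set T. (- n) \<bullet> x = - c} = e ` set (filter (\<lambda>x. f x = 0) T)"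
      using T(2) by auto
    then show ?thesis
      using convex_hull_Int_hyperplane[of "e ` set T" "- c" "- n"] T(1) by fastforce
  qed
  show ?thesis
    using f(4)
  proof
    assume "ok (filter (\<lambda>x. f x = 0) S)"
    then show ?thesis by (rule that) (use common on_S in blast)
  next
    assume "ok (filter (\<lambda>y. f y = 0) T)"
    then show ?thesis by (rule that) (use common on_T in blast)
  qed
qed

lemma lines_affine:
  assumes "f \<in> set (lines P)"
  shows "\<exists>n c. \<forall>x. n \<bullet> real_pair x - c = of_int (f x)"
proof -
  obtain p q where f: "f = iorient p q"
    using assms by (auto simp: lines_def)
  define n :: plane where "n = (of_int (snd p - snd q), of_int (fst q - fst p))"
  have "n \<bullet> real_pair x - n \<bullet> real_pair p = of_int (f x)" for x
    by (simp add: n_def f real_pair_def iorient_def inner_prod_def algebra_simps)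
  then show ?thesis by blast
qed

lemma orient_closed_segment: "x \<in> closed_segment a b \<Longrightarrow> orient a b x = 0"
proof -
  assume "x \<in> closed_segment a b"
  then obtain u where "x = (1 - u) *\<^sub>R a + u *\<^sub>R b + 0 *\<^sub>R a"
    by (auto simp: closed_segment_def)
  then show ?thesis
    by (simp only: orient_convex_combination) simp
qed

text \<open>Two triangles meet in a subset of the chord if a line separates them that contains no vertex of one
of them outside the chord.\<close>

lemma ears_ok_imp_polygonal_disk:
  "ears_ok ts \<Longrightarrow> polygonal_disk (map_prod real_pair real_pair ` set (ear_edges ts))
     (\<Union>(p, q, r)\<in>set ts. convex hull {real_pair p, real_pair q, real_pair r})"
proof (induction ts rule: ears_ok.induct)
  case (2 a c b ts)
  have acb: "orient (real_pair a) (real_pair c) (real_pair b) > 0"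
    using "2.prems" by (simp add: orient_real_pair)
  show ?case
  proof (cases "ts = []")
    case True
    then show ?thesis
      using polygonal_disk_triangle[OF acb] by simp
  next
    case False
    define E where "E = map_prod real_pair real_pair ` set (ear_edges ts)"
    define R where "R = (\<Union>(p, q, r)\<in>set ts. convex hull {real_pair p, real_pair q, real_pair r})"
    have ok: "ears_ok ts" "(a, b) \<in> set (ear_edges ts)"
      and sep: "\<And>p q r. (p, q, r) \<in> set ts \<Longrightarrow>
        separates (lines [a, c, b] @ lines [p, q, r]) [a, c, b] [p, q, r] (\<lambda>Z. set Z \<subseteq> {a, b})"
      and nbr: "\<And>u v. (u, v) \<in> set (ear_edges ts) \<Longrightarrow>
        (v = a \<longrightarrow> iorient a b u > 0 \<or> iorient a u c > 0) \<and>
        (u = b \<longrightarrow> iorient b v a > 0 \<or> iorient b c v > 0) \<and>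
        (v = a \<or> v = b \<or> iorient a b v \<noteq> 0)"
      using "2.prems" False by auto
    have eq: "real_pair p = real_pair q \<longleftrightarrow> p = q" for p q
      using inj_real_pair by (simp add: inj_eq)
    have inE: "(real_pair u, real_pair v) \<in> E \<longleftrightarrow> (u, v) \<in> set (ear_edges ts)" for u v
      by (auto simp: E_def eq)
    have "polygonal_disk (E - {(real_pair a, real_pair b)} \<union> {(real_pair a, real_pair c), (real_pair c, real_pair b)}) (R \<union> convex hull {real_pair a, real_pair c, real_pair b})"
    proof (rule polygonal_disk_add_ear)
      show "polygonal_disk E R"
        using "2.IH" ok False by (simp add: E_def R_def)
      show "(real_pair a, real_pair b) \<in> E"
        using ok(2) by (simp add: inE)
      show "orient (real_pair a) (real_pair c) (real_pair b) > 0" by (fact acb)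
      show "R \<inter> convex hull {real_pair a, real_pair c, real_pair b} \<subseteq> closed_segment (real_pair a) (real_pair b)"
      proof -
        have "convex hull {real_pair p, real_pair q, real_pair r} \<inter> convex hull {real_pair a, real_pair c, real_pair b} \<subseteq> closed_segment (real_pair a) (real_pair b)"
          if pqr: "(p, q, r) \<in> set ts" for p q r
        proof -
          have "\<exists>n d. \<forall>x\<in>set [a, c, b] \<union> set [p, q, r]. n \<bullet> real_pair x - d = of_int (f x)"
            if "f \<in> set (lines [a, c, b] @ lines [p, q, r])" for f
            using that lines_affine[of f] unfolding set_append by blast
          then obtain Z where "set Z \<subseteq> {a, b}"
            "convex hull (real_pair ` set [a, c, b]) \<inter> convex hull (real_pair ` set [p, q, r]) \<subseteq> convex hull (real_pair ` set Z)"
            using separates_imp_Int_convex_hull[OF sep[OF pqr], of real_pair] by blast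
          moreover from this have "convex hull (real_pair ` set Z) \<subseteq> convex hull {real_pair a, real_pair b}"
            by (intro hull_mono) auto
          ultimately show ?thesis
            by (auto simp: segment_convex_hull)
        qed
        moreover have "\<exists>p q r. (p, q, r) \<in> set ts \<and> x \<in> convex hull {real_pair p, real_pair q, real_pair r}" if "x \<in> R" for x
          using that unfolding R_def by blast
        ultimately show ?thesis by blast
      qed
      show "v \<notin> closed_segment (real_pair a) (real_pair b)" if "(u, v) \<in> E" "v \<noteq> real_pair a" "v \<noteq> real_pair b" for u v
      proof
        assume v: "v \<in> closed_segment (real_pair a) (real_pair b)"
        obtain u' v' where "(u', v') \<in> set (ear_edges ts)" "v = real_pair v'"
          using \<open>(u, v) \<in> E\<close> by (auto simp: E_def)
        then show False
          using nbr[of u' v'] that orient_closed_segment[OF v] by (auto simp: orient_real_pair)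
      qed
      show "orient (real_pair a) (real_pair b) u > 0 \<or> orient (real_pair a) u (real_pair c) > 0" if uE: "(u, real_pair a) \<in> E" for u
      proof -
        obtain e where "(u, real_pair a) = map_prod real_pair real_pair e" "e \<in> set (ear_edges ts)"
          using uE unfolding E_def by (rule imageE)
        then have "(fst e, a) \<in> set (ear_edges ts)" "u = real_pair (fst e)"
          by (cases e; simp add: eq)+
        then show ?thesis using nbr[of "fst e" a] by (simp add: orient_real_pair)
      qed
      show "orient (real_pair b) x (real_pair a) > 0 \<or> orient (real_pair b) (real_pair c) x > 0" if xE: "(real_pair b, x) \<in> E" for x
      proof -
        obtain e where "(real_pair b, x) = map_prod real_pair real_pair e" "e \<in> set (ear_edges ts)"
          using xE unfolding E_def by (rule imageE)
        then have "(b, snd e) \<in> set (ear_edges ts)" "x = real_pair (snd e)"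
          by (cases e; simp add: eq)+
        then show ?thesis using nbr[of b "snd e"] by (simp add: orient_real_pair)
      qed
    qed
    moreover have "map_prod real_pair real_pair ` set (ear_edges ((a, c, b) # ts))
        = E - {(real_pair a, real_pair b)} \<union> {(real_pair a, real_pair c), (real_pair c, real_pair b)}"
    proof -
      have "inj (map_prod real_pair real_pair)"
        by (rule prod.inj_map[OF inj_real_pair inj_real_pair])
      then have "map_prod real_pair real_pair ` (set (ear_edges ts) - {(a, b)}) = E - map_prod real_pair real_pair ` {(a, b)}"
        unfolding E_def by (rule image_set_diff)
      then show ?thesis using False by auto
    qed
    moreover have "(\<Union>(p, q, r)\<in>set ((a, c, b) # ts). convex hull {real_pair p, real_pair q, real_pair r})
        = R \<union> convex hull {real_pair a, real_pair c, real_pair b}"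
      by (auto simp: R_def)
    ultimately show ?thesis by simp
  qed
qed simp

section \<open>The faces of the nonagon surface\<close>

definition face_normal :: "nat \<Rightarrow> real^3" where
  "face_normal k = (case face_plane k of (p, q, r, c) \<Rightarrow> real_vec (p, q, r))"

definition face_offset :: "nat \<Rightarrow> real" where
  "face_offset k = (case face_plane k of (p, q, r, c) \<Rightarrow> of_int c)"

abbreviation face_lift :: "nat \<Rightarrow> plane \<Rightarrow> real^3" where
  "face_lift k \<equiv> lift (face_normal k) (face_offset k)"

lemma in_faces: "k \<in> {1..8} \<Longrightarrow> k \<in> set [1..<9]"
  by auto

lemma face_idx_range: "k \<in> {1..8} \<Longrightarrow> i \<in> set (face_idx k) \<Longrightarrow> i \<in> {1..24}"
  using face_idx_properties in_faces[of k] by fastforce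

lemma proj_vert: "i \<in> {1..24} \<Longrightarrow> proj (vert i) = real_pair (shadow i)"
  by (simp add: vert_real_vec proj_def real_pair_def shadow_def real_vec_def split: prod.split)

lemma plane_value_eq:
  assumes "i \<in> {1..24}"
  shows "real_vec (p, q, r) \<bullet> vert i - of_int c = of_int (plane_value (p, q, r, c) i)"
  using assms by (simp add: vert_real_vec real_vec_def inner_3 plane_value_def split: prod.split)

lemma face_normal_not_horizontal: "k \<in> {1..8} \<Longrightarrow> face_normal k $ 3 \<noteq> 0"
  using face_plane_not_vertical[THEN bspec, OF in_faces[of k]]
  by (cases "face_plane k") (simp add: face_normal_def real_vec_def)

lemma inner_face_normal_vert:
  assumes "k \<in> {1..8}" "i \<in> set (face_idx k)"
  shows "face_normal k \<bullet> vert i = face_offset k"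
proof -
  obtain p q r c where pl: "face_plane k = (p, q, r, c)"
    by (metis prod_cases4)
  have "plane_value (p, q, r, c) i = 0"
    using face_planes in_faces[OF assms(1)] assms(2) pl by metis
  then show ?thesis
    using plane_value_eq[OF face_idx_range[OF assms], of p q r c] by (simp add: face_normal_def face_offset_def pl)
qed

lemma face_lift_shadow:
  assumes "k \<in> {1..8}" "i \<in> set (face_idx k)"
  shows "face_lift k (real_pair (shadow i)) = vert i"
  using lift_proj[OF face_normal_not_horizontal[OF assms(1)] inner_face_normal_vert[OF assms]] proj_vert[OF face_idx_range[OF assms]]
  by simp

lemma directed_edges_zip: "directed_edges w = set (zip w (rotate1 w))"
  by (auto simp: directed_edges_def set_zip nth_rotate1)

lemma face_walk_idx: "k \<in> {1..8} \<Longrightarrow> face_walk k = map vert (face_idx k)"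
  by (simp add: face_walk_def face_idx_def)

lemma set_face_walk: "k \<in> {1..8} \<Longrightarrow> set (face_walk k) = vert ` set (face_idx k)"
  by (simp add: face_walk_idx)

lemma directed_edges_face:
  "k \<in> {1..8} \<Longrightarrow> directed_edges (face_walk k) = map_prod vert vert ` set (face_edges k)"
  by (simp add: face_walk_idx directed_edges_zip face_edges_def rotate1_map zip_map_map map_prod_def)

lemma face_edges_in:
  assumes "(i, j) \<in> set (face_edges k)"
  shows "i \<in> set (face_idx k)" "j \<in> set (face_idx k)"
  using assms set_zip_leftD set_zip_rightD unfolding face_edges_def by fastforce+

lemma walk_edges_face:
  "k \<in> {1..8} \<Longrightarrow> walk_edges (face_walk k) = (\<lambda>(i, j). closed_segment (vert i) (vert j)) ` set (face_edges k)"
  unfolding walk_edges_def by (auto simp: directed_edges_face)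

definition shadow_outline :: "nat \<Rightarrow> (plane \<times> plane) set" where
  "shadow_outline k = (\<lambda>(i, j). (real_pair (shadow i), real_pair (shadow j))) ` set (ccw_edges k)"

definition shadow_region :: "nat \<Rightarrow> plane set" where
  "shadow_region k = (\<Union>(p, q, r)\<in>set (shadow_ears k). convex hull {real_pair p, real_pair q, real_pair r})"

lemma polygonal_disk_shadow:
  assumes "k \<in> {1..8}"
  shows "polygonal_disk (shadow_outline k) (shadow_region k)"
proof -
  have "ears_ok (shadow_ears k)"
    using ears_ok_faces in_faces[OF assms] by blast
  moreover have "map_prod real_pair real_pair ` set (ear_edges (shadow_ears k)) = shadow_outline k"
  proof -
    have "set (ear_edges (shadow_ears k)) = map_prod shadow shadow ` set (ccw_edges k)"
      using ears_outline in_faces[OF assms] by simp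
    then show ?thesis
      by (simp add: shadow_outline_def image_image map_prod_def case_prod_beta)
  qed
  ultimately show ?thesis
    using ears_ok_imp_polygonal_disk unfolding shadow_region_def by metis
qed

lemma polygon_face:
  assumes k: "k \<in> {1..8}"
  shows "polygon (face_walk k) = face_lift k ` outline (shadow_outline k)"
proof -
  have seg: "face_lift k ` closed_segment (real_pair (shadow i)) (real_pair (shadow j)) = closed_segment (vert i) (vert j)"
    if "(i, j) \<in> set (face_edges k)" for i j
    using face_edges_in[OF that] by (simp add: lift_segment face_lift_shadow[OF k])
  have "outline (shadow_outline k)
      = (\<Union>e\<in>set (ccw_edges k). closed_segment (real_pair (shadow (fst e))) (real_pair (shadow (snd e))))"
    by (simp add: outline_def shadow_outline_def case_prod_unfold)
  also have "\<dots> = (\<Union>e\<in>set (face_edges k). closed_segment (real_pair (shadow (fst e))) (real_pair (shadow (snd e))))"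
    by (cases "k \<le> 4") (simp_all add: ccw_edges_def closed_segment_commute)
  finally have "face_lift k ` outline (shadow_outline k)
      = (\<Union>(i, j)\<in>set (face_edges k). face_lift k ` closed_segment (real_pair (shadow i)) (real_pair (shadow j)))"
    by (simp add: image_UN case_prod_unfold)
  also have "\<dots> = (\<Union>(i, j)\<in>set (face_edges k). closed_segment (vert i) (vert j))"
    using seg by (intro SUP_cong) auto
  finally show ?thesis
    by (simp add: polygon_def walk_edges_face[OF k])
qed

lemma shadow_ears_cases:
  assumes k: "k \<in> {1..8}" and t: "(p, q, r) \<in> set (shadow_ears k)"
  obtains i j l S where "p = shadow i" "q = shadow j" "r = shadow l" "S \<in> set (pieces k)" "{i, j, l} \<subseteq> set S"
    "{i, j, l} \<subseteq> set (face_idx k)"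
proof -
  obtain i j l where ijl: "(i, j, l) \<in> set (ears k)" "p = shadow i" "q = shadow j" "r = shadow l"
    using t by (auto simp: shadow_ears_def)
  moreover have "\<exists>P\<in>set (pieces k). set [i, j, l] \<subseteq> set P"
    using ears_in_pieces in_faces[OF k] ijl(1) by fast
  moreover have "set P \<subseteq> set (face_idx k)" if "P \<in> set (pieces k)" for P
    using ears_in_pieces in_faces[OF k] that by blast
  ultimately show ?thesis
    using that by (metis (no_types, lifting) list.set(1) list.simps(15) subset_trans)
qed

lemma affine_hull_face:
  assumes k: "k \<in> {1..8}"
  shows "affine hull set (face_walk k) = {x. face_normal k \<bullet> x = face_offset k}"
proof -
  have "ears_ok (shadow_ears k)"
    using ears_ok_faces in_faces[OF k] by blast
  then have "shadow_ears k \<noteq> [] \<and> (case hd (shadow_ears k) of (p, q, r) \<Rightarrow> iorient p q r > 0)"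
    by (cases "shadow_ears k" rule: ears_ok.cases) simp_all
  then obtain p q r where t: "(p, q, r) \<in> set (shadow_ears k)" "iorient p q r > 0"
    by (metis (no_types, lifting) case_prodE hd_in_set)
  then obtain i j l where "p = shadow i" "q = shadow j" "r = shadow l" "{i, j, l} \<subseteq> set (face_idx k)"
    using shadow_ears_cases[OF k t(1)] by metis
  then have "{real_pair p, real_pair q, real_pair r} \<subseteq> (\<lambda>i. real_pair (shadow i)) ` set (face_idx k)" "orient (real_pair p) (real_pair q) (real_pair r) \<noteq> 0"
    using t(2) by (auto simp: orient_real_pair)
  then have "affine hull (face_lift k ` (\<lambda>i. real_pair (shadow i)) ` set (face_idx k)) = {x. face_normal k \<bullet> x = face_offset k}"
    by (rule affine_hull_lift[OF face_normal_not_horizontal[OF k]])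
  moreover have "face_lift k ` (\<lambda>i. real_pair (shadow i)) ` set (face_idx k) = set (face_walk k)"
    by (simp add: image_image face_lift_shadow[OF k] set_face_walk[OF k])
  ultimately show ?thesis by simp
qed

lemma face_region_face:
  assumes k: "k \<in> {1..8}"
  shows "face_region (face_walk k) = face_lift k ` shadow_region k"
  by (rule face_region_lift[OF face_normal_not_horizontal[OF k] polygonal_disk_shadow[OF k] polygon_face[OF k] affine_hull_face[OF k]])

text \<open>Every triangle of the triangulation lies in one of the pieces.\<close>

lemma face_region_subset_pieces:
  assumes k: "k \<in> {1..8}"
  shows "face_region (face_walk k) \<subseteq> (\<Union>S\<in>set (pieces k). convex hull (vert ` set S))"
proof
  fix x assume "x \<in> face_region (face_walk k)"
  then obtain p q r where t: "(p, q, r) \<in> set (shadow_ears k)"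
      and x: "x \<in> face_lift k ` (convex hull {real_pair p, real_pair q, real_pair r})"
    unfolding face_region_face[OF k] shadow_region_def by blast
  obtain i j l S where s: "p = shadow i" "q = shadow j" "r = shadow l" "S \<in> set (pieces k)" "{i, j, l} \<subseteq> set S"
    "{i, j, l} \<subseteq> set (face_idx k)"
    using shadow_ears_cases[OF k t] by metis
  have "x \<in> convex hull {vert i, vert j, vert l}"
    using x s by (simp add: lift_convex_hull_3 face_lift_shadow[OF k])
  then have "x \<in> convex hull (vert ` set S)"
    using hull_mono[of "{vert i, vert j, vert l}" "vert ` set S" convex] s(5) by auto
  then show "x \<in> (\<Union>S\<in>set (pieces k). convex hull (vert ` set S))"
    using s(4) by blast
qed

lemma compact_face: "k \<in> {1..8} \<Longrightarrow> compact (face_region (face_walk k))"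
  using polygonal_disk_shadow[of k] unfolding polygonal_disk_def face_region_face
  by (metis compact_continuous_image continuous_on_lift)

lemma connected_face:
  assumes k: "k \<in> {1..8}"
  shows "connected (face_region (face_walk k))"
proof -
  have "AR (shadow_region k)"
    using polygonal_disk_shadow[OF k] unfolding polygonal_disk_def by blast
  then have "connected (shadow_region k)"
    by (intro path_connected_imp_connected contractible_imp_path_connected AR_imp_contractible)
  then show ?thesis
    unfolding face_region_face[OF k] by (intro connected_continuous_image continuous_on_lift)
qed

lemma polygon_subset_face: "polygon w \<subseteq> face_region w"
  by (auto simp: face_region_def)

lemma set_subset_polygon: "set w \<subseteq> polygon w"
proof
  fix x assume "x \<in> set w"
  then obtain i where "i < length w" "x = w ! i" by (auto simp: in_set_conv_nth)
  then have "x \<in> closed_segment (w ! i) (w ! (Suc i mod length w))"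
    "closed_segment (w ! i) (w ! (Suc i mod length w)) \<in> walk_edges w"
    by (auto simp: walk_edges_def directed_edges_def)
  then show "x \<in> polygon w" by (auto simp: polygon_def)
qed

section \<open>Simplicity and mutual position of the faces\<close>

lemma coords_distinct: "distinct (map coord [1..<25])"
  by code_simp

lemma inj_real_vec: "inj real_vec"
  by (auto simp: inj_def real_vec_def vec_eq_iff forall_3)

lemma inj_on_vert: "inj_on vert {1..24}"
proof -
  have "inj_on coord {1..<25}"
    using coords_distinct by (simp add: distinct_map)
  then have "inj_on (\<lambda>i. real_vec (coord i)) {1..24}"
    using inj_real_vec unfolding inj_on_def by (metis UNIV_I atLeastAtMost_iff atLeastLessThan_iff le_imp_less_Suc eval_nat_numeral(3) numeral_eq_Suc)
  then show ?thesis
    by (rule inj_on_cong[THEN iffD1, rotated]) (simp add: vert_real_vec)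
qed

lemma vert_eq_iff: "i \<in> {1..24} \<Longrightarrow> j \<in> {1..24} \<Longrightarrow> vert i = vert j \<longleftrightarrow> i = j"
  using inj_on_vert by (rule inj_on_eq_iff)

lemma closed_segment_vert_in_walk_edges:
  assumes k: "k \<in> {1..8}" and ij: "i \<in> {1..24}" "j \<in> {1..24}"
  shows "closed_segment (vert i) (vert j) \<in> walk_edges (face_walk k) \<longleftrightarrow>
    (i, j) \<in> set (face_edges k) \<or> (j, i) \<in> set (face_edges k)"
proof -
  have *: "closed_segment (vert i) (vert j) = closed_segment (vert p) (vert q) \<longleftrightarrow> (i = p \<and> j = q) \<or> (i = q \<and> j = p)"
    if "(p, q) \<in> set (face_edges k)" for p q
    using face_edges_in[OF that] face_idx_range[OF k] ij by (simp add: doubleton_eq_iff vert_eq_iff)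
  have in_edges: "closed_segment (vert p) (vert q) \<in> walk_edges (face_walk k)"
    if "(p, q) \<in> set (face_edges k)" for p q
    unfolding walk_edges_face[OF k] by (rule image_eqI[of _ _ "(p, q)"]) (use that in auto)
  show ?thesis
  proof
    assume "closed_segment (vert i) (vert j) \<in> walk_edges (face_walk k)"
    then obtain p q where pq: "(p, q) \<in> set (face_edges k)"
      "closed_segment (vert i) (vert j) = closed_segment (vert p) (vert q)"
      unfolding walk_edges_face[OF k] by auto
    then show "(i, j) \<in> set (face_edges k) \<or> (j, i) \<in> set (face_edges k)"
      using *[OF pq(1)] by blast
  next
    assume "(i, j) \<in> set (face_edges k) \<or> (j, i) \<in> set (face_edges k)"
    then show "closed_segment (vert i) (vert j) \<in> walk_edges (face_walk k)"
      using in_edges[of i j] in_edges[of j i] unfolding closed_segment_commute[of "vert j" "vert i"] by blast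
  qed
qed

lemma face_edges_nth:
  assumes "k \<in> {1..8}"
  shows "(i, j) \<in> set (face_edges k) \<longleftrightarrow> (\<exists>s<9. i = face_idx k ! s \<and> j = face_idx k ! (Suc s mod 9))"
proof -
  have "length (face_idx k) = 9"
    using face_idx_properties in_faces[OF assms] by blast
  then show ?thesis
    by (auto simp: face_edges_def set_zip nth_rotate1)
qed

lemma side_functionals_affine:
  assumes "f \<in> set (side_functionals i j)"
  shows "\<exists>n c. \<forall>x\<in>{1..24}. n \<bullet> vert x - c = of_int (f x)"
proof -
  have *: "vector [a, b, 0] \<bullet> vert x = (a, b) \<bullet> real_pair (shadow x)" if "x \<in> {1..24}" for a b x
    using proj_vert[OF that] by (simp add: inner_3 proj_def real_pair_def inner_prod_def)
  have "\<exists>n c. \<forall>x. n \<bullet> real_pair (shadow x) - c = of_int (f x)"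
  proof -
    have A: "\<exists>n c. \<forall>y. n \<bullet> real_pair y - c = of_int (iorient p q y)" for p q
      by (rule lines_affine[of _ "[p, q]"]) (simp add: lines_def)
    have B: "\<exists>n c. \<forall>y. n \<bullet> real_pair y - c = of_int (fst y - p)" for p
      by (intro exI[of _ "(1, 0)"] exI[of _ "of_int p"]) (simp add: real_pair_def inner_prod_def)
    have C: "\<exists>n c. \<forall>y. n \<bullet> real_pair y - c = of_int (p - fst y)" for p
      by (intro exI[of _ "(- 1, 0)"] exI[of _ "- of_int p"]) (simp add: real_pair_def inner_prod_def)
    have "f \<in> (\<lambda>g x. g (shadow x)) ` {iorient (shadow i) (shadow j), iorient (shadow j) (shadow i),
        \<lambda>y. fst y - fst (shadow i), \<lambda>y. fst y - fst (shadow j),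
        \<lambda>y. fst (shadow i) - fst y, \<lambda>y. fst (shadow j) - fst y}"
      using assms by (simp add: side_functionals_def)
    then obtain g where g: "f = (\<lambda>x. g (shadow x))"
      "g \<in> {iorient (shadow i) (shadow j), iorient (shadow j) (shadow i),
        \<lambda>y. fst y - fst (shadow i), \<lambda>y. fst y - fst (shadow j),
        \<lambda>y. fst (shadow i) - fst y, \<lambda>y. fst (shadow j) - fst y}"
      by (rule imageE)
    have "\<exists>n c. \<forall>y. n \<bullet> real_pair y - c = of_int (g y)"
      using g(2) by (elim insertE emptyE) (simp_all only: A B C)
    then show ?thesis unfolding g(1) by blast
  qed
  then obtain n c where "\<And>x. n \<bullet> real_pair (shadow x) - c = of_int (f x)"
    by blast
  then show ?thesis
    using * by (intro exI[of _ "vector [fst n, snd n, 0]"] exI[of _ c]) simp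
qed

text \<open>Consecutive edges are separated by the line through one of them, which meets the other edge in the common
vertex only.\<close>

lemma simple_polygon_face:
  assumes k: "k \<in> {1..8}"
  shows "simple_polygon (face_walk k)"
proof -
  define w where "w = face_idx k"
  have w: "length w = 9" "distinct w" "set w \<subseteq> {1..24}"
    using face_idx_properties in_faces[OF k] face_idx_range[OF k] unfolding w_def by blast+
  have fw: "face_walk k = map vert w"
    by (simp add: w_def face_walk_idx[OF k])
  define e where "e i = closed_segment (vert (w ! i)) (vert (w ! (Suc i mod 9)))" for i
  define common where "common i j =
    (if j = Suc i mod 9 then {vert (w ! j)} else {}) \<union> (if i = Suc j mod 9 then {vert (w ! i)} else {})" for i j :: nat
  have ends: "vert (w ! i) \<in> e i" "vert (w ! (Suc i mod 9)) \<in> e i" for i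
    by (simp_all add: e_def)
  have at_most_one: "(if P then {x} else {}) \<union> (if Q then {y} else {}) = {} \<or>
      (\<exists>z. (if P then {x} else {}) \<union> (if Q then {y} else {}) = {z})" if "\<not> (P \<and> Q)" for P Q and x y :: "real^3"
    using that by (cases P; cases Q) auto
  have image_ends: "(if P then {vert a} else {}) \<union> (if Q then {vert b} else {})
      = vert ` set ((if P then [a] else []) @ (if Q then [b] else []))" for P Q a b
    by (cases P; cases Q) auto
  have less: "e i \<inter> e j = common i j" if ij: "i < j" "j < 9" for i j
  proof
    let ?S = "[w ! i, w ! (Suc i mod 9)]" and ?T = "[w ! j, w ! (Suc j mod 9)]"
    let ?fs = "side_functionals (w ! i) (w ! (Suc i mod 9)) @ side_functionals (w ! j) (w ! (Suc j mod 9))"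
    let ?C = "(if j = Suc i mod 9 then [w ! j] else []) @ (if i = Suc j mod 9 then [w ! i] else [])"
    have "k \<in> set [1..<9]" "i \<in> set [0..<9]" "j \<in> set [Suc i..<9]"
      using k ij by auto
    then have "separates ?fs ?S ?T (\<lambda>Z. set Z \<subseteq> set ?C)"
      using sides_separated unfolding Let_def w_def by blast
    moreover have "\<exists>n c. \<forall>x\<in>set ?S \<union> set ?T. n \<bullet> vert x - c = of_int (f x)" if f: "f \<in> set ?fs" for f
    proof -
      have "set ?S \<union> set ?T \<subseteq> {1..24}"
        using w ij by (auto simp: subset_iff)
      moreover obtain n c where "\<forall>x\<in>{1..24}. n \<bullet> vert x - c = of_int (f x)"
        using f side_functionals_affine unfolding set_append by blast
      ultimately show ?thesis by blast
    qed
    ultimately obtain Z where Z: "set Z \<subseteq> set ?C"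
      "convex hull (vert ` set ?S) \<inter> convex hull (vert ` set ?T) \<subseteq> convex hull (vert ` set Z)"
      by (rule separates_imp_Int_convex_hull)
    have common_eq: "common i j = vert ` set ?C"
      unfolding common_def by (rule image_ends)
    have "\<not> (j = Suc i mod 9 \<and> i = Suc j mod 9)"
    proof -
      have "Suc i mod 9 = Suc i" "Suc j mod 9 = (if j = 8 then 0 else Suc j)"
        using ij by auto
      then show ?thesis using ij by auto
    qed
    then have "common i j = {} \<or> (\<exists>x. common i j = {x})"
      unfolding common_def by (rule at_most_one)
    then have "convex hull (common i j) = common i j"
      by (elim disjE exE) (simp_all only: convex_hull_empty convex_hull_singleton)
    moreover have "convex hull (vert ` set Z) \<subseteq> convex hull (common i j)"
      unfolding common_eq by (intro hull_mono image_mono Z(1))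
    ultimately show "e i \<inter> e j \<subseteq> common i j"
      using Z(2) by (simp add: e_def segment_convex_hull)
    show "common i j \<subseteq> e i \<inter> e j"
      using ends[of i] ends[of j] by (auto simp: common_def)
  qed
  have "e i \<inter> e j = common i j" if "i < 9" "j < 9" "i \<noteq> j" for i j
  proof (cases "i < j")
    case False
    then have "e j \<inter> e i = common j i" using less that by simp
    then show ?thesis by (simp add: Int_commute common_def Un_commute)
  qed (use less that in simp)
  moreover have "closed_segment (map vert w ! i) (map vert w ! (Suc i mod 9)) = e i" if "i < 9" for i
    using that w(1) by (simp add: e_def)
  moreover have "distinct (map vert w)"
    using w by (simp add: distinct_map inj_on_subset[OF inj_on_vert])
  ultimately show ?thesis
    unfolding simple_polygon_def fw Let_def using w(1) by (simp add: common_def)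
qed

text \<open>The edge starting at the vertex meets any other edge of the simple polygon in common end points only.\<close>

lemma vertex_on_own_edge:
  assumes k: "k \<in> {1..8}" and i: "i \<in> set (face_idx k)" and pq: "(p, q) \<in> set (face_edges k)"
    and on: "vert i \<in> closed_segment (vert p) (vert q)"
  shows "vert i = vert p \<or> vert i = vert q"
proof -
  let ?w = "face_idx k"
  have len: "length ?w = 9"
    using face_idx_properties in_faces[OF k] by blast
  obtain s where s: "s < 9" "i = ?w ! s"
    using i len by (metis in_set_conv_nth)
  obtain m where m: "m < 9" "p = ?w ! m" "q = ?w ! (Suc m mod 9)"
    using pq face_edges_nth[OF k] by auto
  show ?thesis
  proof (cases "s = m")
    case False
    have nth: "face_walk k ! l = vert (?w ! l)" if "l < 9" for l
      using that len by (simp add: face_walk_idx[OF k])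
    have "closed_segment (vert i) (vert (?w ! (Suc s mod 9))) \<inter> closed_segment (vert p) (vert q)
      = (if m = Suc s mod 9 then {vert p} else {}) \<union> (if s = Suc m mod 9 then {vert i} else {})"
      using simple_polygon_face[OF k] False s m len
      by (auto simp: simple_polygon_def Let_def nth face_walk_idx[OF k])
    moreover have "vert i \<in> closed_segment (vert i) (vert (?w ! (Suc s mod 9)))"
      by simp
    ultimately have "vert i = vert p \<or> s = Suc m mod 9"
      using on by (auto split: if_splits)
    then show ?thesis using s m by auto
  qed (use s m in simp)
qed

lemma pieces_separated:
  "k \<in> set [1..<9] \<Longrightarrow> l \<in> set [Suc k..<9] \<Longrightarrow> S \<in> set (pieces k) \<Longrightarrow> T \<in> set (pieces l) \<Longrightarrow>
    separates (map plane_value (separating_planes k l)) S T (common_edge_or_vertex k l)"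
  using pieces_separated_check by blast

lemma faces_intersection_ordered:
  assumes k: "k \<in> {1..8}" and l: "l \<in> {1..8}" and kl: "k < l"
  shows "face_region (face_walk k) \<inter> face_region (face_walk l) \<subseteq>
    set (face_walk k) \<inter> set (face_walk l) \<union> \<Union> (walk_edges (face_walk k) \<inter> walk_edges (face_walk l))"
    (is "_ \<subseteq> ?common")
proof
  fix x assume x: "x \<in> face_region (face_walk k) \<inter> face_region (face_walk l)"
  obtain S T where S: "S \<in> set (pieces k)" "x \<in> convex hull (vert ` set S)"
    and T: "T \<in> set (pieces l)" "x \<in> convex hull (vert ` set T)"
    using x face_region_subset_pieces[OF k] face_region_subset_pieces[OF l] by blast
  have "l \<in> set [Suc k..<9]" using l kl by auto
  then have "separates (map plane_value (separating_planes k l)) S T (common_edge_or_vertex k l)"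
    using pieces_separated in_faces[OF k] S(1) T(1) by blast
  moreover have "\<exists>n c. \<forall>x\<in>set S \<union> set T. n \<bullet> vert x - c = of_int (f x)"
    if f: "f \<in> set (map plane_value (separating_planes k l))" for f
  proof -
    obtain p q r d where "f = plane_value (p, q, r, d)"
      using f by auto
    moreover have "set S \<union> set T \<subseteq> {1..24}"
      using ears_in_pieces in_faces[OF k] in_faces[OF l] S(1) T(1) face_idx_range[OF k] face_idx_range[OF l]
      by blast
    ultimately show ?thesis
      using plane_value_eq[of _ p q r d] by blast
  qed
  ultimately obtain Z where Z: "common_edge_or_vertex k l Z"
    "convex hull (vert ` set S) \<inter> convex hull (vert ` set T) \<subseteq> convex hull (vert ` set Z)"
    by (rule separates_imp_Int_convex_hull)
  have xZ: "x \<in> convex hull (vert ` set Z)"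
    using Z(2) S T by blast
  consider "Z = []" | i where "i \<in> set (face_idx k) \<inter> set (face_idx l)" "Z = [i]"
    | i j where "(i, j) \<in> set (face_edges k)" "(i, j) \<in> set (face_edges l) \<or> (j, i) \<in> set (face_edges l)"
        "Z = [i, j] \<or> Z = [j, i]"
    using Z(1) unfolding common_edge_or_vertex_def by blast
  then show "x \<in> ?common"
  proof cases
    case 1
    then show ?thesis using xZ by simp
  next
    case 2
    then show ?thesis using xZ by (simp add: set_face_walk[OF k] set_face_walk[OF l])
  next
    case 3
    then have "x \<in> closed_segment (vert i) (vert j)"
      using xZ by (auto simp: segment_convex_hull insert_commute)
    moreover have "i \<in> {1..24}" "j \<in> {1..24}"
      using face_edges_in[OF 3(1)] face_idx_range[OF k] by blast+
    ultimately show ?thesis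
      using closed_segment_vert_in_walk_edges[OF k, of i j] closed_segment_vert_in_walk_edges[OF l, of i j] 3 by blast
  qed
qed

lemma faces_intersection:
  assumes k: "k \<in> {1..8}" and l: "l \<in> {1..8}" and kl: "k \<noteq> l"
  shows "face_region (face_walk k) \<inter> face_region (face_walk l) =
    set (face_walk k) \<inter> set (face_walk l) \<union> \<Union> (walk_edges (face_walk k) \<inter> walk_edges (face_walk l))"
proof (rule antisym)
  show "face_region (face_walk k) \<inter> face_region (face_walk l) \<subseteq>
    set (face_walk k) \<inter> set (face_walk l) \<union> \<Union> (walk_edges (face_walk k) \<inter> walk_edges (face_walk l))"
    using faces_intersection_ordered[of k l] faces_intersection_ordered[of l k] assms
    by (cases "k < l") (auto simp: Int_commute)
  have A: "set (face_walk m) \<subseteq> face_region (face_walk m)" for m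
    using polygon_subset_face[of "face_walk m"] set_subset_polygon[of "face_walk m"] by (rule order_trans[rotated])
  have B: "\<Union> (walk_edges (face_walk m)) \<subseteq> face_region (face_walk m)" for m
    using polygon_subset_face[of "face_walk m"] by (simp add: polygon_def)
  show "set (face_walk k) \<inter> set (face_walk l) \<union> \<Union> (walk_edges (face_walk k) \<inter> walk_edges (face_walk l))
      \<subseteq> face_region (face_walk k) \<inter> face_region (face_walk l)"
    using A[of k] A[of l] B[of k] B[of l] by (intro Un_least Int_greatest; blast)
qed

lemma idx_covered: "set (concat (map face_idx [1..<9])) = set [1..<25]"
  by code_simp

text \<open>A vertex in the region of a face that it does not belong to would lie in the intersection with one of
its own faces, hence on a common edge, hence be an end point of that edge.\<close>

lemma vert_in_face:
  assumes k: "k \<in> {1..8}" and i: "i \<in> {1..24}"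
  shows "vert i \<in> face_region (face_walk k) \<longleftrightarrow> i \<in> set (face_idx k)"
proof
  assume "i \<in> set (face_idx k)"
  then show "vert i \<in> face_region (face_walk k)"
    using set_face_walk[OF k] set_subset_polygon[of "face_walk k"] polygon_subset_face[of "face_walk k"] by blast
next
  assume vk: "vert i \<in> face_region (face_walk k)"
  have "i \<in> set (concat (map face_idx [1..<9]))"
    using i unfolding idx_covered by auto
  then obtain l where "l \<in> {1..<9}" and il: "i \<in> set (face_idx l)" by auto
  then have l: "l \<in> {1..8}" "i \<in> set (face_idx l)" by auto
  show "i \<in> set (face_idx k)"
  proof (cases "k = l")
    case False
    have "vert i \<in> face_region (face_walk l)"
      using l set_face_walk[OF l(1)] set_subset_polygon[of "face_walk l"] polygon_subset_face[of "face_walk l"] by blast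
    then consider "vert i \<in> set (face_walk k)"
      | e where "e \<in> walk_edges (face_walk k)" "e \<in> walk_edges (face_walk l)" "vert i \<in> e"
      using vk faces_intersection[OF k l(1) False] by blast
    then show ?thesis
    proof cases
      case 1
      then show ?thesis
        using i face_idx_range[OF k] by (auto simp: set_face_walk[OF k] vert_eq_iff)
    next
      case 2
      obtain p q where pq: "(p, q) \<in> set (face_edges k)" "e = closed_segment (vert p) (vert q)"
        using 2(1) unfolding walk_edges_face[OF k] by auto
      have pqk: "p \<in> set (face_idx k)" "q \<in> set (face_idx k)"
        using face_edges_in[OF pq(1)] by auto
      have r: "p \<in> {1..24}" "q \<in> {1..24}"
        using pqk face_idx_range[OF k] by auto
      have "(p, q) \<in> set (face_edges l) \<or> (q, p) \<in> set (face_edges l)"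
        using 2(2) closed_segment_vert_in_walk_edges[OF l(1) r] pq(2) by simp
      then have "vert i = vert p \<or> vert i = vert q"
        using vertex_on_own_edge[OF l(1,2)] 2(3) unfolding pq(2) by (metis closed_segment_commute)
      then show ?thesis
        using pqk r i by (auto simp: vert_eq_iff)
    qed
  qed (use l in simp)
qed

section \<open>The vertices of the nonagon surface\<close>

text \<open>Cramer's rule with the triple product as determinant.\<close>

lemma frame_map_inj:
  assumes "a \<bullet> cross3 b c \<noteq> 0"
  shows "inj (frame_map a b c)"
  unfolding linear_injective_0[OF linear_frame_map]
proof (intro allI impI)
  fix t assume t: "frame_map a b c t = 0"
  have "t $ 1 * (a \<bullet> cross3 b c) = frame_map a b c t \<bullet> cross3 b c"
    "t $ 2 * (a \<bullet> cross3 b c) = frame_map a b c t \<bullet> cross3 c a"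
    "t $ 3 * (a \<bullet> cross3 b c) = frame_map a b c t \<bullet> cross3 a b"
    by (simp_all add: frame_map_def inner_3 cross3_def algebra_simps)
  then show "t = 0"
    using assms t by (simp add: vec_eq_iff forall_3)
qed

definition idiff :: "int \<times> int \<times> int \<Rightarrow> int \<times> int \<times> int \<Rightarrow> int \<times> int \<times> int" where
  "idiff = (\<lambda>(x, y, z) (x', y', z'). (x - x', y - y', z - z'))"

definition idet :: "int \<times> int \<times> int \<Rightarrow> int \<times> int \<times> int \<Rightarrow> int \<times> int \<times> int \<Rightarrow> int" where
  "idet = (\<lambda>(a1, a2, a3) (b1, b2, b3) (c1, c2, c3).
     a1 * (b2 * c3 - b3 * c2) + a2 * (b3 * c1 - b1 * c3) + a3 * (b1 * c2 - b2 * c1))"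

lemma real_vec_idiff: "real_vec (idiff a b) = real_vec a - real_vec b"
  by (cases a; cases b) (simp add: idiff_def real_vec_def vec_eq_iff forall_3)

lemma real_vec_idet: "real_vec a \<bullet> cross3 (real_vec b) (real_vec c) = of_int (idet a b c)"
  by (cases a; cases b; cases c) (simp add: idet_def real_vec_def inner_3 cross3_def)

definition has_corner :: "nat \<Rightarrow> nat \<Rightarrow> nat \<Rightarrow> nat \<Rightarrow> bool \<Rightarrow> bool" where
  "has_corner k u v x conv \<longleftrightarrow> k \<in> set [1..<9] \<and>
     ((u, v) \<in> set (ccw_edges k) \<and> (v, x) \<in> set (ccw_edges k) \<and>
        iorient (shadow u) (shadow v) (shadow x) \<noteq> 0 \<and> (iorient (shadow u) (shadow v) (shadow x) > 0) = conv \<or>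
      (x, v) \<in> set (ccw_edges k) \<and> (v, u) \<in> set (ccw_edges k) \<and>
        iorient (shadow x) (shadow v) (shadow u) \<noteq> 0 \<and> (iorient (shadow x) (shadow v) (shadow u) > 0) = conv)"

text \<open>An entry \<open>(v, a, b, c, k, l, m, conv)\<close> lists the neighbors of \<open>v\<close> and the faces with the corners
\<open>a v b\<close>, \<open>b v c\<close>, \<open>c v a\<close>, arranged so that only the last corner can be reflex.\<close>

definition vertex_figures :: "(nat \<times> nat \<times> nat \<times> nat \<times> nat \<times> nat \<times> nat \<times> bool) list" where
  "vertex_figures = [
     (1, 12, 2, 5, 5, 1, 4, False), (2, 6, 11, 1, 7, 5, 1, False),
     (3, 17, 4, 8, 6, 2, 3, False), (4, 9, 16, 3, 8, 6, 2, False),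
     (5, 1, 8, 7, 4, 3, 1, True), (6, 10, 2, 19, 1, 7, 4, False),
     (7, 5, 18, 14, 1, 5, 3, False), (8, 3, 5, 13, 3, 4, 2, True),
     (9, 15, 4, 23, 2, 8, 3, False), (10, 16, 6, 21, 1, 4, 8, False),
     (11, 2, 15, 18, 7, 2, 5, False), (12, 20, 19, 1, 8, 4, 5, False),
     (13, 8, 22, 21, 2, 6, 4, False), (14, 7, 15, 24, 3, 7, 5, False),
     (15, 11, 9, 14, 2, 3, 7, False), (16, 4, 10, 22, 8, 1, 6, False),
     (17, 24, 23, 3, 7, 3, 6, False), (18, 7, 11, 22, 5, 2, 1, False),
     (19, 12, 6, 23, 4, 7, 8, False), (20, 24, 21, 12, 6, 8, 5, True),
     (21, 13, 10, 20, 4, 8, 6, False), (22, 13, 16, 18, 6, 1, 2, False),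
     (23, 17, 9, 19, 3, 8, 7, False), (24, 14, 17, 20, 7, 6, 5, True)]"

lemma vertex_figures_correct:
  "\<forall>(v, a, b, c, k, l, m, conv)\<in>set vertex_figures.
     has_corner k a v b True \<and> has_corner l b v c True \<and> has_corner m c v a conv \<and>
     (\<forall>f\<in>set [1..<9]. v \<in> set (face_idx f) \<longrightarrow> f = k \<or> f = l \<or> f = m) \<and>
     idet (idiff (coord a) (coord v)) (idiff (coord b) (coord v)) (idiff (coord c) (coord v)) \<noteq> 0"
  by code_simp

lemma vertex_figures_complete: "map fst vertex_figures = [1..<25]"
  by code_simp

lemma ccw_edges_in:
  assumes "(i, j) \<in> set (ccw_edges k)"
  shows "i \<in> set (face_idx k)" "j \<in> set (face_idx k)"
proof -
  have "(i, j) \<in> set (face_edges k) \<or> (j, i) \<in> set (face_edges k)"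
    using assms by (auto simp: ccw_edges_def split: if_splits)
  then show "i \<in> set (face_idx k)" "j \<in> set (face_idx k)"
    using face_edges_in[of i j k] face_edges_in[of j i k] by blast+
qed

lemma face_at_corner_ccw:
  assumes k: "k \<in> {1..8}" and E: "(u, v) \<in> set (ccw_edges k)" "(v, x) \<in> set (ccw_edges k)"
    and o: "iorient (shadow u) (shadow v) (shadow x) \<noteq> 0"
  shows "\<forall>\<^sub>F y in nhds (vert v). y \<in> face_region (face_walk k) \<longleftrightarrow>
    y - vert v \<in> space_corner (vert u - vert v) (vert x - vert v) (iorient (shadow u) (shadow v) (shadow x) > 0)"
proof -
  have "(real_pair (shadow u), real_pair (shadow v)) \<in> shadow_outline k" "(real_pair (shadow v), real_pair (shadow x)) \<in> shadow_outline k"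
    using E unfolding shadow_outline_def by force+
  then show ?thesis
    using polygonal_disk_corner[OF face_normal_not_horizontal[OF k] polygonal_disk_shadow[OF k], of "real_pair (shadow u)" "real_pair (shadow v)"
        "real_pair (shadow x)" "face_offset k"] o ccw_edges_in[OF E(1)] ccw_edges_in[OF E(2)]
    by (simp add: face_region_face[OF k] face_lift_shadow[OF k] orient_real_pair)
qed

lemma face_at_corner:
  assumes "has_corner k u v x conv"
  shows "\<forall>\<^sub>F y in nhds (vert v). y \<in> face_region (face_walk k) \<longleftrightarrow>
    y - vert v \<in> space_corner (vert u - vert v) (vert x - vert v) conv"
proof -
  have k: "k \<in> {1..8}"
    using assms by (auto simp: has_corner_def)
  from assms consider "(u, v) \<in> set (ccw_edges k)" "(v, x) \<in> set (ccw_edges k)"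
        "iorient (shadow u) (shadow v) (shadow x) \<noteq> 0" "(iorient (shadow u) (shadow v) (shadow x) > 0) = conv"
      | "(x, v) \<in> set (ccw_edges k)" "(v, u) \<in> set (ccw_edges k)"
        "iorient (shadow x) (shadow v) (shadow u) \<noteq> 0" "(iorient (shadow x) (shadow v) (shadow u) > 0) = conv"
    unfolding has_corner_def by blast
  then show ?thesis
  proof cases
    case 1
    then show ?thesis using face_at_corner_ccw[OF k 1(1-3)] by simp
  next
    case 2
    then show ?thesis using face_at_corner_ccw[OF k 2(1-3)] by (simp add: space_corner_commute)
  qed
qed

lemma surface_union_nonagon: "surface_union nonagon_surface = (\<Union>k\<in>{1..8}. face_region (face_walk k))"
  by (simp add: surface_union_def surface_faces_def nonagon_surface_def)

text \<open>The other five faces are closed and avoid the vertex, so only the three corners matter near it.\<close>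

lemma vertex_disk:
  assumes v: "v \<in> {1..24}"
  shows "\<exists>U. openin (top_of_set (surface_union nonagon_surface)) U \<and> vert v \<in> U \<and>
    U homeomorphic ball (0::real^2) 1"
proof -
  have "v \<in> set (map fst vertex_figures)"
    using v unfolding vertex_figures_complete by auto
  then obtain a b c k l m conv where row: "(v, a, b, c, k, l, m, conv) \<in> set vertex_figures"
    by force
  have corners: "has_corner k a v b True" "has_corner l b v c True" "has_corner m c v a conv"
    and only: "\<And>f. f \<in> set [1..<9] \<Longrightarrow> v \<in> set (face_idx f) \<Longrightarrow> f = k \<or> f = l \<or> f = m"
    and det: "idet (idiff (coord a) (coord v)) (idiff (coord b) (coord v)) (idiff (coord c) (coord v)) \<noteq> 0"
    using vertex_figures_correct[THEN bspec, OF row] by auto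
  have klm: "k \<in> {1..8}" "l \<in> {1..8}" "m \<in> {1..8}"
    using corners by (auto simp: has_corner_def)
  have abc: "a \<in> {1..24}" "b \<in> {1..24}" "c \<in> {1..24}"
    using corners(1,2) ccw_edges_in face_idx_range klm unfolding has_corner_def by blast+
  show ?thesis
  proof (rule disk_at_vertex)
    have "(vert a - vert v) \<bullet> cross3 (vert b - vert v) (vert c - vert v) \<noteq> 0"
      using det v abc real_vec_idet[of "idiff (coord a) (coord v)" "idiff (coord b) (coord v)" "idiff (coord c) (coord v)"]
      by (simp add: vert_real_vec real_vec_idiff)
    then show "inj (frame_map (vert a - vert v) (vert b - vert v) (vert c - vert v))"
      by (rule frame_map_inj)
    have "\<forall>\<^sub>F y in nhds (vert v). \<forall>f\<in>{1..8} - {k, l, m}. y \<notin> face_region (face_walk f)"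
    proof (rule eventually_ball_finite)
      show "\<forall>f\<in>{1..8} - {k, l, m}. \<forall>\<^sub>F y in nhds (vert v). y \<notin> face_region (face_walk f)"
      proof
        fix f assume f: "f \<in> {1..8} - {k, l, m}"
        then have f8: "f \<in> {1..8}" by blast
        have "v \<notin> set (face_idx f)"
          using only[OF in_faces[OF f8]] f by blast
        then show "\<forall>\<^sub>F y in nhds (vert v). y \<notin> face_region (face_walk f)"
          using vert_in_face[OF f8 v] compact_face[OF f8]
          by (intro eventually_not_in_closed compact_imp_closed) auto
      qed
    qed simp
    then show "\<forall>\<^sub>F y in nhds (vert v). y \<in> surface_union nonagon_surface \<longleftrightarrow>
      y - vert v \<in> space_corner (vert a - vert v) (vert b - vert v) True \<union>
        space_corner (vert b - vert v) (vert c - vert v) True \<union>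
        space_corner (vert c - vert v) (vert a - vert v) conv"
      using face_at_corner[OF corners(1)] face_at_corner[OF corners(2)] face_at_corner[OF corners(3)]
    proof eventually_elim
      case (elim y)
      have "y \<in> surface_union nonagon_surface \<longleftrightarrow>
          y \<in> face_region (face_walk k) \<or> y \<in> face_region (face_walk l) \<or> y \<in> face_region (face_walk m)"
        using elim(1) klm unfolding surface_union_nonagon by blast
      then show ?case using elim(2-4) by blast
    qed
  qed
qed

lemma surface_vertices_nonagon: "surface_vertices nonagon_surface = vert ` {1..24}"
proof -
  have "{1..8::nat} = {1..<9}" by auto
  then have "(\<Union>k\<in>{1..8}. set (face_idx k)) = set (concat (map face_idx [1..<9]))"
    by simp
  also have "\<dots> = {1..24}"
    unfolding idx_covered by auto
  finally have "(\<Union>k\<in>{1..8}. set (face_idx k)) = {1..24}" .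
  moreover have "surface_vertices nonagon_surface = (\<Union>k\<in>{1..8}. vert ` set (face_idx k))"
    by (simp add: surface_vertices_def nonagon_surface_def set_face_walk)
  ultimately show ?thesis by (simp add: image_UN[symmetric])
qed

lemma coplanar_face:
  assumes k: "k \<in> {1..8}"
  shows "coplanar (set (face_walk k))"
proof -
  have "affine hull (face_lift k ` {(0, 0), (1, 0), (0, 1)}) = {x. face_normal k \<bullet> x = face_offset k}"
    by (rule affine_hull_lift[OF face_normal_not_horizontal[OF k], of "(0, 0)" "(1, 0)" "(0, 1)"]) (auto simp: orient_def cross2_def)
  then have "set (face_walk k) \<subseteq> affine hull {face_lift k (0, 0), face_lift k (1, 0), face_lift k (0, 1)}"
    using affine_hull_face[OF k] hull_subset[of "set (face_walk k)" affine] by simp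
  then show ?thesis
    unfolding coplanar_def by blast
qed

lemma polyhedral_surface_nonagon: "polyhedral_surface nonagon_surface"
  unfolding polyhedral_surface_def
proof (intro conjI ballI impI)
  show "finite nonagon_surface"
    by (simp add: nonagon_surface_def)
  show "planar_simple_face w" if "w \<in> nonagon_surface" for w
    using that simple_polygon_face coplanar_face by (auto simp: nonagon_surface_def planar_simple_face_def)
  show "\<exists>A B. A \<subseteq> set w \<inter> set w' \<and> B \<subseteq> walk_edges w \<inter> walk_edges w' \<and>
      face_region w \<inter> face_region w' = A \<union> \<Union> B"
    if w: "w \<in> nonagon_surface" "w' \<in> nonagon_surface" "w \<noteq> w'" for w w'
  proof -
    obtain k l where "k \<in> {1..8}" "w = face_walk k" "l \<in> {1..8}" "w' = face_walk l"
      using w unfolding nonagon_surface_def by blast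
    then show ?thesis
      using faces_intersection[of k l] w(3) by blast
  qed
  show "\<exists>U. openin (top_of_set (surface_union nonagon_surface)) U \<and> x \<in> U \<and>
      U homeomorphic ball (0::real^2) 1" if "x \<in> surface_vertices nonagon_surface" for x
    using that vertex_disk unfolding surface_vertices_nonagon by blast
qed

section \<open>Incidences, orientation and connectedness\<close>

definition sorted_pair :: "nat \<times> nat \<Rightarrow> nat \<times> nat" where
  "sorted_pair e = (min (fst e) (snd e), max (fst e) (snd e))"

definition edge_list :: "(nat \<times> nat) list" where
  "edge_list = remdups (map sorted_pair (concat (map face_edges [1..<9])))"

definition seg :: "nat \<times> nat \<Rightarrow> (real^3) set" where
  "seg e = closed_segment (vert (fst e)) (vert (snd e))"

lemma seg_sorted_pair: "seg (sorted_pair e) = seg e"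
  by (simp add: seg_def sorted_pair_def min_def max_def insert_commute)

lemma edge_list_range: "\<forall>(i, j)\<in>set edge_list. i < j \<and> i \<in> set [1..<25] \<and> j \<in> set [1..<25]"
  by code_simp

lemma length_edge_list: "length edge_list = 36"
  by code_simp

lemma edge_faces: "\<forall>(i, j)\<in>set edge_list.
    length (filter (\<lambda>k. (i, j) \<in> set (face_edges k) \<or> (j, i) \<in> set (face_edges k)) [1..<9]) = 2"
  by code_simp

lemma vertex_edges_faces: "\<forall>v\<in>set [1..<25]. length (filter (\<lambda>(i, j). v = i \<or> v = j) edge_list) = 3 \<and>
    length (filter (\<lambda>k. v \<in> set (face_idx k)) [1..<9]) = 3"
  by code_simp

text \<open>Reversing the faces 3 to 6 makes the two directions of every edge cancel.\<close>

definition oriented_idx :: "nat \<Rightarrow> nat list" where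
  "oriented_idx k = (if 3 \<le> k \<and> k \<le> 6 then rev (face_idx k) else face_idx k)"

definition oriented_edges :: "nat \<Rightarrow> (nat \<times> nat) list" where
  "oriented_edges k = zip (oriented_idx k) (rotate1 (oriented_idx k))"

lemma orientation_compatible: "\<forall>k\<in>set [1..<9]. \<forall>l\<in>set [1..<9]. k \<noteq> l \<longrightarrow>
    (\<forall>(i, j)\<in>set (oriented_edges k). (i, j) \<in> set (face_edges l) \<or> (j, i) \<in> set (face_edges l) \<longrightarrow>
       (j, i) \<in> set (oriented_edges l))"
  by code_simp

lemma faces_have_private_vertex: "\<forall>k\<in>set [1..<9]. \<forall>l\<in>set [1..<9]. k \<noteq> l \<longrightarrow>
    (\<exists>i\<in>set (face_idx k). i \<notin> set (face_idx l))"
  by code_simp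

lemma faces_meet_first: "\<forall>k\<in>set [1..<9]. \<exists>i\<in>set (face_idx k). i \<in> set (face_idx 1)"
  by code_simp

lemma edge_list_in:
  assumes "e \<in> set edge_list"
  shows "fst e < snd e" "fst e \<in> {1..24}" "snd e \<in> {1..24}"
  using edge_list_range[THEN bspec, OF assms] by auto

lemma seg_eq_iff:
  assumes "i \<in> {1..24}" "j \<in> {1..24}" "p \<in> {1..24}" "q \<in> {1..24}"
  shows "seg (i, j) = seg (p, q) \<longleftrightarrow> (i = p \<and> j = q) \<or> (i = q \<and> j = p)"
  using assms by (simp add: seg_def doubleton_eq_iff vert_eq_iff)

lemma inj_on_seg: "inj_on seg (set edge_list)"
proof (rule inj_onI)
  fix d e assume "d \<in> set edge_list" "e \<in> set edge_list" "seg d = seg e"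
  then show "d = e"
    using edge_list_in[of d] edge_list_in[of e] seg_eq_iff[of "fst d" "snd d" "fst e" "snd e"]
    by (auto simp: prod_eq_iff)
qed

lemma inj_on_face_walk: "inj_on face_walk {1..8}"
proof (rule inj_onI, rule ccontr)
  fix k l assume kl: "k \<in> {1..8}" "l \<in> {1..8}" "face_walk k = face_walk l" "k \<noteq> l"
  obtain i where i: "i \<in> set (face_idx k)" "i \<notin> set (face_idx l)"
    using faces_have_private_vertex in_faces[OF kl(1)] in_faces[OF kl(2)] kl(4) by blast
  have "vert i \<in> face_region (face_walk k)" "vert i \<notin> face_region (face_walk l)"
    using vert_in_face[OF kl(1) face_idx_range[OF kl(1) i(1)]] vert_in_face[OF kl(2) face_idx_range[OF kl(1) i(1)]] i
    by simp_all
  then show False using kl(3) by simp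
qed

lemma inj_on_face_region: "inj_on face_region nonagon_surface"
proof (rule inj_onI, rule ccontr)
  fix w w' assume w: "w \<in> nonagon_surface" "w' \<in> nonagon_surface" "face_region w = face_region w'" "w \<noteq> w'"
  obtain k l where kl: "k \<in> {1..8}" "w = face_walk k" "l \<in> {1..8}" "w' = face_walk l"
    using w unfolding nonagon_surface_def by blast
  then obtain i where i: "i \<in> set (face_idx k)" "i \<notin> set (face_idx l)"
    using faces_have_private_vertex[THEN bspec, OF in_faces[OF kl(1)], THEN bspec, OF in_faces[OF kl(3)]] w(4)
    by blast
  then show False
    using vert_in_face[OF kl(1) face_idx_range[OF kl(1) i(1)]] vert_in_face[OF kl(3) face_idx_range[OF kl(1) i(1)]]
      w(3) kl by simp
qed

lemma interval_upt: "{1..8::nat} = set [1..<9]"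
  by auto

lemma surface_edges_nonagon: "surface_edges nonagon_surface = seg ` set edge_list"
proof -
  have "surface_edges nonagon_surface = (\<Union>k\<in>{1..8}. seg ` set (face_edges k))"
    by (simp add: surface_edges_def nonagon_surface_def walk_edges_face seg_def case_prod_unfold)
  also have "\<dots> = seg ` set (concat (map face_edges [1..<9]))"
    unfolding interval_upt set_concat set_map image_UN by (simp only: image_image)
  also have "\<dots> = seg ` sorted_pair ` set (concat (map face_edges [1..<9]))"
    by (simp only: image_image seg_sorted_pair)
  finally show ?thesis unfolding edge_list_def by (simp only: set_remdups set_map)
qed

lemma card_surface_vertices_nonagon: "card (vert ` {1..24}) = 24"
  using card_image[OF inj_on_vert] by simp

lemma card_surface_edges_nonagon: "card (surface_edges nonagon_surface) = 36"
proof -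
  have "card (set edge_list) = 36"
    using length_edge_list unfolding edge_list_def by (simp only: length_remdups_card_conv set_remdups)
  then show ?thesis
    unfolding surface_edges_nonagon by (simp only: card_image[OF inj_on_seg])
qed

lemma card_nonagon_surface: "card nonagon_surface = 8"
  using card_image[OF inj_on_face_walk] by (simp add: nonagon_surface_def)

lemma card_surface_faces_nonagon: "card (surface_faces nonagon_surface) = 8"
  by (simp add: surface_faces_def card_image inj_on_face_region card_nonagon_surface)

lemma card_walks:
  "card {w \<in> nonagon_surface. P w} = length (filter (\<lambda>k. P (face_walk k)) [1..<9])"
proof -
  have "{w \<in> nonagon_surface. P w} = face_walk ` ({k. P (face_walk k)} \<inter> {1..8})"
    by (auto simp: nonagon_surface_def)
  then have "card {w \<in> nonagon_surface. P w} = card ({k. P (face_walk k)} \<inter> {1..8})"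
    by (simp add: card_image inj_on_subset[OF inj_on_face_walk])
  then show ?thesis
    unfolding interval_upt by (simp add: distinct_length_filter)
qed

lemma closed_surface_nonagon: "closed_surface nonagon_surface"
  unfolding closed_surface_def surface_edges_nonagon
proof (intro ballI)
  fix s assume "s \<in> seg ` set edge_list"
  then obtain i j where ij: "(i, j) \<in> set edge_list" "s = seg (i, j)" by auto
  have "filter (\<lambda>k. s \<in> walk_edges (face_walk k)) [1..<9]
      = filter (\<lambda>k. (i, j) \<in> set (face_edges k) \<or> (j, i) \<in> set (face_edges k)) [1..<9]"
  proof (rule filter_cong[OF refl])
    fix k assume "k \<in> set [1..<9]"
    then have "k \<in> {1..8}" by (simp only: interval_upt)
    then show "s \<in> walk_edges (face_walk k) \<longleftrightarrow> (i, j) \<in> set (face_edges k) \<or> (j, i) \<in> set (face_edges k)"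
      using closed_segment_vert_in_walk_edges[of k i j] edge_list_in[OF ij(1)] by (simp add: ij(2) seg_def)
  qed
  then show "card {w \<in> nonagon_surface. s \<in> walk_edges w} = 2"
    unfolding card_walks using edge_faces[THEN bspec, OF ij(1)] by simp
qed

lemma orientable_surface_nonagon: "orientable_surface nonagon_surface"
proof -
  define flip where "flip w = (if w \<in> face_walk ` {3..6} then rev w else w)" for w :: walk
  have flip_face: "flip (face_walk k) = map vert (oriented_idx k)" if k: "k \<in> {1..8}" for k
  proof -
    have "face_walk k \<in> face_walk ` {3..6} \<longleftrightarrow> k \<in> {3..6}"
      by (rule inj_on_image_mem_iff[OF inj_on_face_walk k]) auto
    then show ?thesis
      by (simp add: flip_def oriented_idx_def face_walk_idx[OF k] rev_map)
  qed
  have edges: "directed_edges (flip (face_walk k)) = map_prod vert vert ` set (oriented_edges k)"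
    if k: "k \<in> {1..8}" for k
    by (simp add: flip_face[OF k] directed_edges_zip oriented_edges_def rotate1_map zip_map_map map_prod_def)
  show ?thesis
    unfolding orientable_surface_def
  proof (intro exI[of _ flip] conjI ballI impI allI)
    show "flip w = w \<or> flip w = rev w" for w
      by (simp add: flip_def)
    fix w w' a b
    assume w: "w \<in> nonagon_surface" "w' \<in> nonagon_surface" "w \<noteq> w'"
      and ab: "(a, b) \<in> directed_edges (flip w) \<and> closed_segment a b \<in> walk_edges w'"
    obtain k l where kl: "k \<in> {1..8}" "w = face_walk k" "l \<in> {1..8}" "w' = face_walk l"
      using w unfolding nonagon_surface_def by blast
    have "(a, b) \<in> map_prod vert vert ` set (oriented_edges k)"
      using ab unfolding kl(2) edges[OF kl(1)] by (rule conjunct1)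
    then obtain e where e: "(a, b) = map_prod vert vert e" "e \<in> set (oriented_edges k)"
      by (rule imageE)
    define i j where "i = fst e" "j = snd e"
    have ij: "(i, j) \<in> set (oriented_edges k)" "a = vert i" "b = vert j"
      using e by (simp_all add: i_j_def prod_eq_iff)
    have "set (oriented_idx k) = set (face_idx k)"
      by (simp add: oriented_idx_def)
    then have "i \<in> {1..24}" "j \<in> {1..24}"
      using ij(1) set_zip_leftD[of i j] set_zip_rightD[of i j] face_idx_range[OF kl(1)]
      unfolding oriented_edges_def by fastforce+
    then have "(i, j) \<in> set (face_edges l) \<or> (j, i) \<in> set (face_edges l)"
      using ab closed_segment_vert_in_walk_edges[OF kl(3)] unfolding kl(4) ij(2,3) by blast
    moreover have "k \<noteq> l" using w(3) kl by blast
    ultimately have "(j, i) \<in> set (oriented_edges l)"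
      using orientation_compatible[THEN bspec, OF in_faces[OF kl(1)], THEN bspec, OF in_faces[OF kl(3)]] ij(1)
      by blast
    then show "(b, a) \<in> directed_edges (flip w')"
      unfolding kl(4) edges[OF kl(3)] ij(2,3) by force
  qed
qed

lemma equivelar_nonagon: "equivelar nonagon_surface 9 3"
  unfolding equivelar_def
proof (intro conjI ballI)
  show "length w = 9" if "w \<in> nonagon_surface" for w
    using that face_idx_properties in_faces by (fastforce simp: nonagon_surface_def face_walk_idx)
next
  fix x assume "x \<in> surface_vertices nonagon_surface"
  then obtain k where k: "k \<in> {1..8}" "x \<in> set (face_walk k)"
    by (auto simp: surface_vertices_def nonagon_surface_def)
  then obtain v where v: "x = vert v" "v \<in> {1..24}"
    using face_idx_range[OF k(1)] by (auto simp: set_face_walk)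
  then have "v \<in> set [1..<25]" by auto
  note counts = vertex_edges_faces[THEN bspec, OF this]
  have "{s \<in> surface_edges nonagon_surface. x extreme_point_of s}
      = seg ` ({(i, j). v = i \<or> v = j} \<inter> set edge_list)"
  proof -
    have "x extreme_point_of seg e \<longleftrightarrow> v = fst e \<or> v = snd e" if "e \<in> set edge_list" for e
      using edge_list_in[OF that] v by (simp add: seg_def extreme_point_of_segment vert_eq_iff)
    then show ?thesis
      unfolding surface_edges_nonagon by auto
  qed
  then have "card {s \<in> surface_edges nonagon_surface. x extreme_point_of s}
      = card ({(i, j). v = i \<or> v = j} \<inter> set edge_list)"
    by (simp add: card_image inj_on_subset[OF inj_on_seg])
  also have "\<dots> = length (filter (\<lambda>(i, j). v = i \<or> v = j) edge_list)"
    by (rule distinct_length_filter[symmetric]) (simp only: edge_list_def distinct_remdups)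
  finally show "card {s \<in> surface_edges nonagon_surface. x extreme_point_of s} = 3"
    using counts by simp
  have "filter (\<lambda>k. x \<in> set (face_walk k)) [1..<9] = filter (\<lambda>k. v \<in> set (face_idx k)) [1..<9]"
  proof (rule filter_cong[OF refl])
    fix k assume "k \<in> set [1..<9]"
    then have k: "k \<in> {1..8}" by (simp only: interval_upt)
    show "x \<in> set (face_walk k) \<longleftrightarrow> v \<in> set (face_idx k)"
      using v face_idx_range[OF k] by (auto simp: set_face_walk[OF k] vert_eq_iff)
  qed
  then show "card {w \<in> nonagon_surface. x \<in> set w} = 3"
    unfolding card_walks using counts by simp
qed

text \<open>Every face shares a vertex with the first one.\<close>

lemma connected_surface_nonagon: "connected (surface_union nonagon_surface)"
proof -
  let ?F = "\<lambda>k. face_region (face_walk k)"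
  have "connected (\<Union>k\<in>{1..8}. ?F 1 \<union> ?F k)"
  proof (rule connected_Union)
    fix s assume "s \<in> (\<lambda>k. ?F 1 \<union> ?F k) ` {1..8}"
    then obtain k where k: "k \<in> {1..8}" "s = ?F 1 \<union> ?F k" by blast
    obtain i where "i \<in> set (face_idx k)" "i \<in> set (face_idx 1)"
      using faces_meet_first in_faces[OF k(1)] by blast
    then have "vert i \<in> ?F 1 \<inter> ?F k"
      using vert_in_face[of 1 i] vert_in_face[OF k(1), of i] face_idx_range[OF k(1)] by simp
    then show "connected s"
      unfolding k(2) using connected_face[of 1] connected_face[OF k(1)] by (intro connected_Un) auto
  next
    have "vert 6 \<in> ?F 1"
      by (subst vert_in_face) (simp_all add: face_idx_def)
    then show "(\<Inter>k\<in>{1..8}. ?F 1 \<union> ?F k) \<noteq> {}" by blast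
  qed
  moreover have "(\<Union>k\<in>{1..8}. ?F 1 \<union> ?F k) = surface_union nonagon_surface"
    unfolding surface_union_def surface_faces_def nonagon_surface_def by force
  ultimately show ?thesis by simp
qed

section \<open>The rotatory reflection of the surface\<close>

lemma connected_component_set_homeomorphic_image:
  assumes f: "continuous_on UNIV f" and g: "continuous_on UNIV g" and gf: "\<And>x. g (f x) = x"
    and x: "x \<in> S"
  shows "connected_component_set (f ` S) (f x) = f ` connected_component_set S x"
proof
  have "connected (f ` connected_component_set S x)"
    by (intro connected_continuous_image connected_connected_component continuous_on_subset[OF f]) auto
  moreover have "f x \<in> f ` connected_component_set S x"
    using x by (intro imageI) simp
  moreover have "f ` connected_component_set S x \<subseteq> f ` S"
    by (intro image_mono connected_component_subset)
  ultimately show "f ` connected_component_set S x \<subseteq> connected_component_set (f ` S) (f x)"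
    by (intro connected_component_maximal)
  let ?C = "connected_component_set (f ` S) (f x)"
  have "connected (g ` ?C)"
    by (intro connected_continuous_image connected_connected_component continuous_on_subset[OF g]) auto
  moreover have "x \<in> g ` ?C"
  proof (rule image_eqI)
    show "x = g (f x)" by (simp add: gf)
    show "f x \<in> ?C" using x by simp
  qed
  moreover have "g ` ?C \<subseteq> S"
  proof -
    have "g ` ?C \<subseteq> g ` f ` S"
      by (intro image_mono connected_component_subset)
    then show ?thesis by (simp add: image_image gf)
  qed
  ultimately have sub: "g ` ?C \<subseteq> connected_component_set S x"
    by (intro connected_component_maximal)
  show "?C \<subseteq> f ` connected_component_set S x"
  proof
    fix y assume y: "y \<in> ?C"
    then have "y \<in> f ` S"
      using connected_component_subset[of "f ` S" "f x"] by blast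
    then have "f (g y) = y" using gf by auto
    moreover have "g y \<in> connected_component_set S x"
      using sub y by blast
    ultimately show "y \<in> f ` connected_component_set S x"
      by (intro image_eqI[of _ _ "g y"]) simp_all
  qed
qed

lemma walk_edges_linear_image:
  assumes "linear f"
  shows "walk_edges (map f w) = (`) f ` walk_edges w"
proof -
  have edges: "directed_edges (map f w) = map_prod f f ` directed_edges w"
    by (simp add: directed_edges_zip rotate1_map zip_map_map map_prod_def)
  have "walk_edges v = (\<lambda>(a, b). closed_segment a b) ` directed_edges v" for v
    by (auto simp: walk_edges_def)
  then show ?thesis
    by (simp add: edges image_image case_prod_unfold closed_segment_linear_image[OF assms])
qed

lemma face_region_linear_image:
  assumes f: "linear f" and g: "linear g" and gf: "\<And>x. g (f x) = x"
  shows "face_region (map f w) = f ` face_region w"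
proof -
  have cont: "continuous_on A f" "continuous_on A g" for A
    using f g by (simp_all add: linear_continuous_on linear_conv_bounded_linear[symmetric])
  have injf: "inj f"
    by (rule inj_on_inverseI[of _ g]) (simp add: gf)
  have P: "polygon (map f w) = f ` polygon w"
    unfolding polygon_def walk_edges_linear_image[OF f] by (rule image_Union[symmetric])
  define D where "D = affine hull set w - polygon w"
  have D: "affine hull set (map f w) - polygon (map f w) = f ` D"
    unfolding P D_def set_map affine_hull_linear_image[OF f[unfolded linear_conv_bounded_linear], symmetric] by (rule image_set_diff[OF injf, symmetric])
  have bd: "bounded (f ` A) \<longleftrightarrow> bounded A" for A
  proof
    assume "bounded (f ` A)"
    then have "bounded (g ` f ` A)"
      using bounded_linear_image g linear_conv_bounded_linear by blast
    then show "bounded A" by (simp add: image_image gf)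
  next
    show "bounded A \<Longrightarrow> bounded (f ` A)"
      using bounded_linear_image f linear_conv_bounded_linear by blast
  qed
  have comp: "bounded (connected_component_set (f ` D) (f x)) \<longleftrightarrow> bounded (connected_component_set D x)"
    if "x \<in> D" for x
    using connected_component_set_homeomorphic_image[OF cont gf that] bd by simp
  have "face_region (map f w) = f ` polygon w \<union> {y \<in> f ` D. bounded (connected_component_set (f ` D) y)}"
    unfolding face_region_def D unfolding P ..
  also have "{y \<in> f ` D. bounded (connected_component_set (f ` D) y)} = f ` {x \<in> D. bounded (connected_component_set D x)}"
    using comp by auto
  also have "f ` polygon w \<union> \<dots> = f ` face_region w"
    by (simp add: face_region_def D_def image_Un)
  finally show ?thesis .
qed

text \<open>The region depends on the walk only through its vertices and edges, so it does not change when the walk is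
rotated or reversed.\<close>

lemma face_region_cong:
  "set w = set w' \<Longrightarrow> walk_edges w = walk_edges w' \<Longrightarrow> face_region w = face_region w'"
  by (simp add: face_region_def polygon_def)

text \<open>The quarter turn about the third axis combined with the reflection in the horizontal plane.\<close>

definition rho :: "real^3 \<Rightarrow> real^3" where
  "rho x = vector [- x $ 2, x $ 1, - x $ 3]"

lemma linear_rho: "linear rho"
  by (rule linearI) (simp_all add: rho_def vec_eq_iff forall_3)

lemma rho_4: "rho (rho (rho (rho x))) = x"
  by (simp add: rho_def vec_eq_iff forall_3)

lemma dist_rho: "dist (rho x) (rho y) = dist x y"
  by (simp add: rho_def dist_norm norm_vec_def L2_set_def sum_3 power2_eq_square algebra_simps)

definition rho_vertex :: "nat \<Rightarrow> nat" where
  "rho_vertex i = [21, 10, 14, 15, 20, 16, 12, 24, 11, 4, 6, 13, 17, 1, 2, 9, 7, 19, 22, 8, 3, 23, 18, 5] ! (i - 1)"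

definition rho_face :: "nat \<Rightarrow> nat" where
  "rho_face k = [8, 7, 5, 6, 4, 3, 1, 2] ! (k - 1)"

lemma rho_vertex_coord: "\<forall>i\<in>set [1..<25]. coord (rho_vertex i) =
    (case coord i of (x, y, z) \<Rightarrow> (- y, x, - z))"
  by code_simp

lemma rho_vertex_perm: "set (map rho_vertex [1..<25]) = set [1..<25]"
  by code_simp

lemma rho_face_perm: "set (map rho_face [1..<9]) = set [1..<9]"
  by code_simp

lemma rho_face_vertices: "\<forall>k\<in>set [1..<9]. set (map rho_vertex (face_idx k)) = set (face_idx (rho_face k))"
  by code_simp

lemma rho_face_edges: "\<forall>k\<in>set [1..<9].
    (\<forall>(i, j)\<in>set (face_edges k). (rho_vertex i, rho_vertex j) \<in> set (face_edges (rho_face k)) \<or>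
       (rho_vertex j, rho_vertex i) \<in> set (face_edges (rho_face k))) \<and>
    (\<forall>(i, j)\<in>set (face_edges (rho_face k)). \<exists>(p, q)\<in>set (face_edges k).
       (i = rho_vertex p \<and> j = rho_vertex q) \<or> (i = rho_vertex q \<and> j = rho_vertex p))"
  by code_simp

definition sq_dist :: "nat \<Rightarrow> nat \<Rightarrow> int" where
  "sq_dist i j = (case (coord i, coord j) of ((x, y, z), (x', y', z')) \<Rightarrow>
     (x - x')\<^sup>2 + (y - y')\<^sup>2 + (z - z')\<^sup>2)"

text \<open>The number is the largest squared distance between two vertices.\<close>

lemma sq_dist_diameter: "\<forall>i\<in>set [1..<25]. \<forall>j\<in>set [1..<25]. sq_dist i j = 399024 \<longrightarrow>
    (i, j) \<in> set [(5, 20), (5, 24), (8, 20), (8, 24), (20, 5), (24, 5), (20, 8), (24, 8)]"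
  by code_simp

text \<open>The images of vertex 1 under the four symmetries of the tetrahedron 5, 8, 20, 24 that are not powers of
\<^term>\<open>rho\<close>.\<close>

lemma mirror_images_not_vertices:
  "(72, 84, 18) \<notin> set coords \<and> (-72, -84, 18) \<notin> set coords \<and>
   (84, -72, -18) \<notin> set coords \<and> (-84, 72, -18) \<notin> set coords"
  by code_simp

lemma rho_vert:
  assumes i: "i \<in> {1..24}"
  shows "rho_vertex i \<in> {1..24}" "rho (vert i) = vert (rho_vertex i)"
proof -
  have i': "i \<in> set [1..<25]" using i by auto
  then have "rho_vertex i \<in> set (map rho_vertex [1..<25])" by simp
  then show r: "rho_vertex i \<in> {1..24}"
    unfolding rho_vertex_perm by auto
  show "rho (vert i) = vert (rho_vertex i)"
    using rho_vertex_coord[THEN bspec, OF i']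
    by (simp add: vert_real_vec[OF i] vert_real_vec[OF r] real_vec_def rho_def vec_eq_iff forall_3 split: prod.splits)
qed

lemma rho_face_range: "k \<in> {1..8} \<Longrightarrow> rho_face k \<in> {1..8}"
proof -
  assume "k \<in> {1..8}"
  then have "rho_face k \<in> set (map rho_face [1..<9])" by auto
  then show ?thesis unfolding rho_face_perm by auto
qed

lemma rho_face_surj: "rho_face ` {1..8} = {1..8}"
proof -
  have "{1..8} = set [1..<9]" by auto
  then show ?thesis using rho_face_perm by (simp only: set_map)
qed

lemma rho_set_face_walk:
  assumes k: "k \<in> {1..8}"
  shows "rho ` set (face_walk k) = set (face_walk (rho_face k))"
proof -
  have "rho ` set (face_walk k) = vert ` rho_vertex ` set (face_idx k)"
    using rho_vert(2)[OF face_idx_range[OF k]] by (simp add: set_face_walk[OF k] image_image)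
  then show ?thesis
    using rho_face_vertices[THEN bspec, OF in_faces[OF k]]
    by (simp add: set_face_walk[OF rho_face_range[OF k]])
qed

lemma rho_walk_edges:
  assumes k: "k \<in> {1..8}"
  shows "(`) rho ` walk_edges (face_walk k) = walk_edges (face_walk (rho_face k))"
proof -
  note checks = rho_face_edges[THEN bspec, OF in_faces[OF k]]
  have seg: "rho ` closed_segment (vert i) (vert j) = closed_segment (vert (rho_vertex i)) (vert (rho_vertex j))"
    if "(i, j) \<in> set (face_edges k)" for i j
    using face_edges_in[OF that] face_idx_range[OF k]
    by (simp add: closed_segment_linear_image[OF linear_rho, symmetric] rho_vert)
  have range: "rho_vertex i \<in> {1..24}" "rho_vertex j \<in> {1..24}" if "(i, j) \<in> set (face_edges k)" for i j
    using face_edges_in[OF that] face_idx_range[OF k] rho_vert(1) by blast+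
  show ?thesis
  proof
    show "(`) rho ` walk_edges (face_walk k) \<subseteq> walk_edges (face_walk (rho_face k))"
    proof
      fix s assume "s \<in> (`) rho ` walk_edges (face_walk k)"
      then obtain i j where ij: "(i, j) \<in> set (face_edges k)" "s = rho ` closed_segment (vert i) (vert j)"
        unfolding walk_edges_face[OF k] by auto
      then show "s \<in> walk_edges (face_walk (rho_face k))"
        using closed_segment_vert_in_walk_edges[OF rho_face_range[OF k] range[OF ij(1)]] checks
        unfolding ij(2) seg[OF ij(1)] by blast
    qed
    show "walk_edges (face_walk (rho_face k)) \<subseteq> (`) rho ` walk_edges (face_walk k)"
    proof
      fix s assume "s \<in> walk_edges (face_walk (rho_face k))"
      then obtain i j where ij: "(i, j) \<in> set (face_edges (rho_face k))" "s = closed_segment (vert i) (vert j)"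
        unfolding walk_edges_face[OF rho_face_range[OF k]] by auto
      then obtain p q where pq: "(p, q) \<in> set (face_edges k)"
        "(i = rho_vertex p \<and> j = rho_vertex q) \<or> (i = rho_vertex q \<and> j = rho_vertex p)"
        using checks by blast
      have "s = rho ` closed_segment (vert p) (vert q)"
        using pq(2) unfolding ij(2) seg[OF pq(1)] by (auto simp: insert_commute)
      moreover have "closed_segment (vert p) (vert q) \<in> walk_edges (face_walk k)"
        unfolding walk_edges_face[OF k] by (rule image_eqI[OF _ pq(1)]) simp
      ultimately show "s \<in> (`) rho ` walk_edges (face_walk k)" by blast
    qed
  qed
qed

lemma rho_face_region:
  assumes k: "k \<in> {1..8}"
  shows "rho ` face_region (face_walk k) = face_region (face_walk (rho_face k))"
proof -
  have "linear (rho \<circ> rho \<circ> rho)"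
    by (intro linear_compose linear_rho)
  then have "face_region (map rho (face_walk k)) = rho ` face_region (face_walk k)"
    by (rule face_region_linear_image[OF linear_rho]) (simp add: rho_4)
  moreover have "face_region (map rho (face_walk k)) = face_region (face_walk (rho_face k))"
    by (rule face_region_cong)
      (simp_all add: rho_set_face_walk[OF k] walk_edges_linear_image[OF linear_rho] rho_walk_edges[OF k])
  ultimately show ?thesis by simp
qed

section \<open>The symmetry group\<close>

lemma symmetries_compose:
  assumes "f \<in> surface_symmetries W" "g \<in> surface_symmetries W"
  shows "f \<circ> g \<in> surface_symmetries W"
proof -
  have comp: "(f \<circ> g) ` X = f ` g ` X" "(`) (f \<circ> g) ` Y = (`) f ` (`) g ` Y" for X Y
    by (simp_all add: image_comp comp_def image_image)
  show ?thesis
    using assms unfolding surface_symmetries_def mem_Collect_eq comp by simp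
qed

lemma id_symmetry: "id \<in> surface_symmetries W"
  by (simp add: surface_symmetries_def)

lemma rho_symmetry: "rho \<in> surface_symmetries nonagon_surface"
proof -
  have vertices: "rho ` surface_vertices nonagon_surface = surface_vertices nonagon_surface"
  proof -
    have "rho ` surface_vertices nonagon_surface = (\<Union>k\<in>{1..8}. set (face_walk (rho_face k)))"
      by (simp add: surface_vertices_def nonagon_surface_def image_UN rho_set_face_walk)
    also have "\<dots> = (\<Union>k\<in>rho_face ` {1..8}. set (face_walk k))"
      by simp
    finally show ?thesis
      unfolding rho_face_surj by (simp add: surface_vertices_def nonagon_surface_def)
  qed
  have edges: "(`) rho ` surface_edges nonagon_surface = surface_edges nonagon_surface"
  proof -
    have "(`) rho ` surface_edges nonagon_surface = (\<Union>k\<in>{1..8}. walk_edges (face_walk (rho_face k)))"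
      by (simp add: surface_edges_def nonagon_surface_def image_UN rho_walk_edges)
    also have "\<dots> = (\<Union>k\<in>rho_face ` {1..8}. walk_edges (face_walk k))"
      by simp
    finally show ?thesis
      unfolding rho_face_surj by (simp add: surface_edges_def nonagon_surface_def)
  qed
  have faces: "(`) rho ` surface_faces nonagon_surface = surface_faces nonagon_surface"
  proof -
    have "(`) rho ` surface_faces nonagon_surface = (\<lambda>k. face_region (face_walk (rho_face k))) ` {1..8}"
      by (simp add: surface_faces_def nonagon_surface_def image_image rho_face_region)
    also have "\<dots> = (\<lambda>k. face_region (face_walk k)) ` rho_face ` {1..8}"
      by (simp only: image_image)
    finally show ?thesis
      unfolding rho_face_surj by (simp add: surface_faces_def nonagon_surface_def image_image)
  qed
  have "rho ` surface_union nonagon_surface = surface_union nonagon_surface"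
    unfolding surface_union_def using faces by (simp add: image_Union)
  then show ?thesis
    using vertices edges faces by (simp add: surface_symmetries_def dist_rho)
qed

lemma power2_dist_3:
  "(dist x y)\<^sup>2 = (x $ 1 - y $ 1)\<^sup>2 + (x $ 2 - y $ 2)\<^sup>2 + (x $ 3 - (y :: real^3) $ 3)\<^sup>2"
  unfolding dist_norm power2_norm_eq_inner inner_3 by (simp add: power2_eq_square)

lemma dist_vert:
  assumes "i \<in> {1..24}" "j \<in> {1..24}"
  shows "(dist (vert i) (vert j))\<^sup>2 = of_int (sq_dist i j)"
  using assms by (simp add: power2_dist_3 vert_real_vec real_vec_def sq_dist_def split: prod.split)

text \<open>The pairs at maximal distance form a cycle of length four through 5, 20, 8, 24, and a symmetry maps this cycle
to itself.\<close>

lemma diameter_images: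
  assumes f: "\<And>x y. dist (f x) (f y) = dist x y" and V: "f ` vert ` {1..24} = vert ` {1..24}"
  obtains i m j l where "f (vert 5) = vert i" "f (vert 8) = vert m" "f (vert 20) = vert j" "f (vert 24) = vert l"
    "(i, m, j, l) \<in> {(5, 8, 20, 24), (5, 8, 24, 20), (8, 5, 20, 24), (8, 5, 24, 20),
       (20, 24, 5, 8), (20, 24, 8, 5), (24, 20, 5, 8), (24, 20, 8, 5)}"
proof -
  have ex: "\<exists>j\<in>{1..24}. f (vert i) = vert j" if "i \<in> {1..24}" for i
    using V that by blast
  obtain i where i: "i \<in> {1..24}" "f (vert 5) = vert i" using ex[of 5] by auto
  obtain m where m: "m \<in> {1..24}" "f (vert 8) = vert m" using ex[of 8] by auto
  obtain j where j: "j \<in> {1..24}" "f (vert 20) = vert j" using ex[of 20] by auto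
  obtain l where l: "l \<in> {1..24}" "f (vert 24) = vert l" using ex[of 24] by auto
  let ?D = "set [(5, 20), (5, 24), (8, 20), (8, 24), (20, 5), (24, 5), (20, 8), (24, 8)] :: (nat \<times> nat) set"
  have diam: "(a', b') \<in> ?D" if "a' \<in> {1..24}" "b' \<in> {1..24}" "f (vert a) = vert a'" "f (vert b) = vert b'"
    "a \<in> {1..24}" "b \<in> {1..24}" "sq_dist a b = 399024" for a b a' b'
  proof -
    have "(of_int (sq_dist a' b') :: real) = of_int (sq_dist a b)"
      using f[of "vert a" "vert b"] dist_vert[of a' b'] dist_vert[of a b] that by simp
    then have "sq_dist a' b' = 399024"
      using that(7) by linarith
    moreover have "a' \<in> set [1..<25]" "b' \<in> set [1..<25]" using that(1,2) by auto
    ultimately show ?thesis using sq_dist_diameter by blast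
  qed
  have "sq_dist 5 20 = 399024" "sq_dist 5 24 = 399024" "sq_dist 8 20 = 399024" "sq_dist 8 24 = 399024"
    by (simp_all add: sq_dist_def coord_def coords_def)
  then have D: "(i, j) \<in> ?D" "(i, l) \<in> ?D" "(m, j) \<in> ?D" "(m, l) \<in> ?D"
    using diam[of i j 5 20] diam[of i l 5 24] diam[of m j 8 20] diam[of m l 8 24] i m j l by simp_all
  have im: "i \<noteq> m"
  proof
    assume "i = m"
    then have "dist (f (vert 5)) (f (vert 8)) = 0" using i(2) m(2) by simp
    then show False by (simp add: f vert_eq_iff)
  qed
  have jl: "j \<noteq> l"
  proof
    assume "j = l"
    then have "dist (f (vert 20)) (f (vert 24)) = 0" using j(2) l(2) by simp
    then show False by (simp add: f vert_eq_iff)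
  qed
  have "(i, m, j, l) \<in> {(5, 8, 20, 24), (5, 8, 24, 20), (8, 5, 20, 24), (8, 5, 24, 20),
       (20, 24, 5, 8), (20, 24, 8, 5), (24, 20, 5, 8), (24, 20, 8, 5)}"
    using D(1)[unfolded list.set]
    by (elim insertE emptyE Pair_inject) (use D(2-4) im jl in auto)
  then show ?thesis
    by (rule that[OF i(2) m(2) j(2) l(2)])
qed

text \<open>With signs \<open>s\<close> and \<open>t\<close> these are the eight symmetries of the tetrahedron with corners 5, 8, 20, 24.\<close>

definition signed_map :: "bool \<Rightarrow> real \<Rightarrow> real \<Rightarrow> real^3 \<Rightarrow> real^3" where
  "signed_map sw s t x = (if sw then vector [s * x $ 2, t * x $ 1, - x $ 3] else vector [s * x $ 1, t * x $ 2, x $ 3])"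

lemma long_vertices:
  "vert 5 = vector [0, 300, 234]" "vert 8 = vector [0, - 300, 234]"
  "vert 20 = vector [- 300, 0, - 234]" "vert 24 = vector [300, 0, - 234]"
  by (simp_all add: vert_real_vec real_vec_def coord_def coords_def)

text \<open>A point is determined by its distances from the corners of the tetrahedron. The four corners have the
same norm, so differences of the squared distances are linear equations that can be solved for the image point.\<close>

lemma isometry_signed_map:
  assumes f: "\<And>x y. dist (f x) (f y) = dist x y" and V: "f ` vert ` {1..24} = vert ` {1..24}"
  obtains sw s t where "s \<in> {1, - 1}" "t \<in> {1, - 1}" "f = signed_map sw s t"
proof -
  obtain i m j l where im: "f (vert 5) = vert i" "f (vert 8) = vert m" "f (vert 20) = vert j" "f (vert 24) = vert l"
    "(i, m, j, l) \<in> {(5, 8, 20, 24), (5, 8, 24, 20), (8, 5, 20, 24), (8, 5, 24, 20),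
       (20, 24, 5, 8), (20, 24, 8, 5), (24, 20, 5, 8), (24, 20, 8, 5)}"
    by (rule diameter_images[OF f V])
  have sq: "(p $ 1 - a $ 1)\<^sup>2 + (p $ 2 - a $ 2)\<^sup>2 + (p $ 3 - a $ 3)\<^sup>2
      = (x $ 1 - b $ 1)\<^sup>2 + (x $ 2 - b $ 2)\<^sup>2 + (x $ 3 - b $ 3)\<^sup>2"
    if "dist p a = dist x b" for p a x b :: "real^3"
    using that unfolding power2_dist_3[symmetric] by simp
  have eqs: "(f x $ 1 - vert i $ 1)\<^sup>2 + (f x $ 2 - vert i $ 2)\<^sup>2 + (f x $ 3 - vert i $ 3)\<^sup>2
      = (x $ 1)\<^sup>2 + (x $ 2 - 300)\<^sup>2 + (x $ 3 - 234)\<^sup>2"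
    "(f x $ 1 - vert m $ 1)\<^sup>2 + (f x $ 2 - vert m $ 2)\<^sup>2 + (f x $ 3 - vert m $ 3)\<^sup>2
      = (x $ 1)\<^sup>2 + (x $ 2 + 300)\<^sup>2 + (x $ 3 - 234)\<^sup>2"
    "(f x $ 1 - vert j $ 1)\<^sup>2 + (f x $ 2 - vert j $ 2)\<^sup>2 + (f x $ 3 - vert j $ 3)\<^sup>2
      = (x $ 1 + 300)\<^sup>2 + (x $ 2)\<^sup>2 + (x $ 3 + 234)\<^sup>2"
    "(f x $ 1 - vert l $ 1)\<^sup>2 + (f x $ 2 - vert l $ 2)\<^sup>2 + (f x $ 3 - vert l $ 3)\<^sup>2
      = (x $ 1 - 300)\<^sup>2 + (x $ 2)\<^sup>2 + (x $ 3 + 234)\<^sup>2" for x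
    using sq[OF f[of x "vert 5", unfolded im(1)]] sq[OF f[of x "vert 8", unfolded im(2)]]
      sq[OF f[of x "vert 20", unfolded im(3)]] sq[OF f[of x "vert 24", unfolded im(4)]]
    by (simp_all add: long_vertices)
  note ex = eqs[unfolded power2_eq_square]
  from im(5) consider "(i, m, j, l) = (5, 8, 20, 24)" | "(i, m, j, l) = (5, 8, 24, 20)"
    | "(i, m, j, l) = (8, 5, 20, 24)" | "(i, m, j, l) = (8, 5, 24, 20)"
    | "(i, m, j, l) = (20, 24, 5, 8)" | "(i, m, j, l) = (20, 24, 8, 5)"
    | "(i, m, j, l) = (24, 20, 5, 8)" | "(i, m, j, l) = (24, 20, 8, 5)"
    by (elim insertE emptyE)
  then show ?thesis
  proof cases
    case 1
    have "f x = signed_map False 1 1 x" for x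
      using ex[of x] 1 by (simp add: long_vertices signed_map_def vec_eq_iff forall_3 algebra_simps)
    then show ?thesis by (intro that[of 1 1 False] ext) simp_all
  next
    case 2
    have "f x = signed_map False (-1) 1 x" for x
      using ex[of x] 2 by (simp add: long_vertices signed_map_def vec_eq_iff forall_3 algebra_simps)
    then show ?thesis by (intro that[of "-1" 1 False] ext) simp_all
  next
    case 3
    have "f x = signed_map False 1 (-1) x" for x
      using ex[of x] 3 by (simp add: long_vertices signed_map_def vec_eq_iff forall_3 algebra_simps)
    then show ?thesis by (intro that[of 1 "-1" False] ext) simp_all
  next
    case 4
    have "f x = signed_map False (-1) (-1) x" for x
      using ex[of x] 4 by (simp add: long_vertices signed_map_def vec_eq_iff forall_3 algebra_simps)
    then show ?thesis by (intro that[of "-1" "-1" False] ext) simp_all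
  next
    case 5
    have "f x = signed_map True (-1) (-1) x" for x
      using ex[of x] 5 by (simp add: long_vertices signed_map_def vec_eq_iff forall_3 algebra_simps)
    then show ?thesis by (intro that[of "-1" "-1" True] ext) simp_all
  next
    case 6
    have "f x = signed_map True (-1) 1 x" for x
      using ex[of x] 6 by (simp add: long_vertices signed_map_def vec_eq_iff forall_3 algebra_simps)
    then show ?thesis by (intro that[of "-1" 1 True] ext) simp_all
  next
    case 7
    have "f x = signed_map True 1 (-1) x" for x
      using ex[of x] 7 by (simp add: long_vertices signed_map_def vec_eq_iff forall_3 algebra_simps)
    then show ?thesis by (intro that[of 1 "-1" True] ext) simp_all
  next
    case 8
    have "f x = signed_map True 1 1 x" for x
      using ex[of x] 8 by (simp add: long_vertices signed_map_def vec_eq_iff forall_3 algebra_simps)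
    then show ?thesis by (intro that[of 1 1 True] ext) simp_all
  qed
qed

lemma rho_powers:
  "rho ^^ 0 = signed_map False 1 1" "rho ^^ 1 = signed_map True (-1) 1"
  "rho ^^ 2 = signed_map False (-1) (-1)" "rho ^^ 3 = signed_map True 1 (-1)"
  by (simp_all add: fun_eq_iff numeral_eq_Suc rho_def signed_map_def vec_eq_iff forall_3)

lemma not_vertex: "(x, y, z) \<notin> set coords \<Longrightarrow> vector [of_int x, of_int y, of_int z] \<notin> vert ` {1..24}"
proof
  assume n: "(x, y, z) \<notin> set coords"
  assume "vector [of_int x, of_int y, of_int z] \<in> vert ` {1..24}"
  then obtain i where i: "i \<in> {1..24}" "real_vec (x, y, z) = vert i"
    by (auto simp: real_vec_def)
  then have "(x, y, z) = coord i"
    using inj_real_vec by (simp add: vert_real_vec inj_eq)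
  moreover have "coord i \<in> set coords"
    unfolding coord_def using i(1) by (intro nth_mem) (auto simp: coords_def)
  ultimately show False using n by simp
qed

lemma symmetries_nonagon: "surface_symmetries nonagon_surface = (\<lambda>n. rho ^^ n) ` {0..<4}"
proof
  have pow: "rho ^^ n \<in> surface_symmetries nonagon_surface" for n
    by (induction n) (simp_all only: funpow.simps id_symmetry symmetries_compose rho_symmetry)
  then show "(\<lambda>n. rho ^^ n) ` {0..<4} \<subseteq> surface_symmetries nonagon_surface" by blast
  show "surface_symmetries nonagon_surface \<subseteq> (\<lambda>n. rho ^^ n) ` {0..<4}"
  proof
    fix f assume "f \<in> surface_symmetries nonagon_surface"
    then have f: "\<And>x y. dist (f x) (f y) = dist x y" and V: "f ` vert ` {1..24} = vert ` {1..24}"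
      by (simp_all add: surface_symmetries_def surface_vertices_nonagon)
    obtain sw s t where st: "s \<in> {1, - 1}" "t \<in> {1, - 1}" "f = signed_map sw s t"
      by (rule isometry_signed_map[OF f V])
    have v1: "vert 1 = vector [-72, 84, 18]"
      by (simp add: vert_real_vec real_vec_def coord_def coords_def)
    have "f (vert 1) \<in> vert ` {1..24}"
      using V by auto
    then have image: "(if sw then vector [s * 84, t * - 72, - 18] else vector [s * - 72, t * 84, 18]) \<in> vert ` {1..24}"
      unfolding st(3) v1 by (cases sw) (simp_all add: signed_map_def)
    have no: "vector [72, 84, 18] \<notin> vert ` {1..24}" "vector [-72, -84, 18] \<notin> vert ` {1..24}"
       "vector [84, -72, -18] \<notin> vert ` {1..24}" "vector [-84, 72, -18] \<notin> vert ` {1..24}"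
      using mirror_images_not_vertices not_vertex[of 72 84 18] not_vertex[of "-72" "-84" 18]
        not_vertex[of 84 "-72" "-18"] not_vertex[of "-84" 72 "-18"] by simp_all
    have "(\<not> sw \<and> s = 1 \<and> t = 1) \<or> (sw \<and> s = - 1 \<and> t = 1) \<or> (\<not> sw \<and> s = - 1 \<and> t = - 1) \<or> (sw \<and> s = 1 \<and> t = - 1)"
      using st(1,2) by (elim insertE emptyE; cases sw; use image no in simp)
    then have "f = rho ^^ 0 \<or> f = rho ^^ 1 \<or> f = rho ^^ 2 \<or> f = rho ^^ 3"
      unfolding rho_powers st(3) by (elim disjE conjE) simp_all
    then show "f \<in> (\<lambda>n. rho ^^ n) ` {0..<4}"
      by (elim disjE) (rule image_eqI, assumption, simp)+
  qed
qed

lemma monoid_symmetry_group: "monoid (symmetry_group W)"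
  by (rule monoidI) (simp_all add: symmetry_group_def symmetries_compose id_symmetry o_assoc)

text \<open>The powers of \<^term>\<open>rho\<close> are told apart by their values at one point with trivial stabilizer.\<close>

lemma symmetry_group_iso: "(\<lambda>n. rho ^^ nat n) \<in> iso (integer_mod_group 4) (symmetry_group nonagon_surface)"
proof -
  have add: "rho ^^ nat ((x + y) mod 4) = (rho ^^ nat x) \<circ> (rho ^^ nat y)" if "x \<ge> 0" "y \<ge> 0" for x y
  proof -
    have "rho ^^ (m mod 4) = rho ^^ m" for m
      by (rule ext, rule funpow_mod_eq) (simp add: numeral_eq_Suc rho_4)
    moreover have "nat ((x + y) mod 4) = (nat x + nat y) mod 4"
      using that by (simp add: nat_mod_distrib nat_add_distrib)
    ultimately show ?thesis by (simp add: funpow_add)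
  qed
  have inj: "inj_on (\<lambda>n. rho ^^ n) {0..<4}"
  proof (rule inj_onI)
    fix m n :: nat assume mn: "m \<in> {0..<4}" "n \<in> {0..<4}" "rho ^^ m = rho ^^ n"
    \<comment> \<open>any point off the third axis has four distinct images\<close>
    define p :: "real^3" where "p = vector [1, 2, 0]"
    have vals: "(rho ^^ 0) p = vector [1, 2, 0]" "(rho ^^ 1) p = vector [-2, 1, 0]"
      "(rho ^^ 2) p = vector [-1, -2, 0]" "(rho ^^ 3) p = vector [2, -1, 0]"
      unfolding rho_powers p_def by (simp_all add: signed_map_def)
    have "m \<in> {0, 1, 2, 3}" "n \<in> {0, 1, 2, 3}" using mn by auto
    moreover have "(rho ^^ m) p = (rho ^^ n) p" using mn by simp
    ultimately show "m = n"
      using vals by (elim insertE emptyE) (simp_all add: vec_eq_iff forall_3)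
  qed
  have nat_image: "nat ` {0..<4} = {0..<4}"
  proof -
    have "{0..<4} = int ` {0..<4}"
      by (simp add: image_int_atLeastLessThan)
    then show ?thesis by (simp add: image_image)
  qed
  have "bij_betw (\<lambda>n. rho ^^ nat n) {0..<4} (surface_symmetries nonagon_surface)"
    unfolding bij_betw_def
  proof
    show "inj_on (\<lambda>n. rho ^^ nat n) {0..<4}"
    proof (rule inj_onI)
      fix x y :: int assume "x \<in> {0..<4}" "y \<in> {0..<4}" "rho ^^ nat x = rho ^^ nat y"
      then show "x = y"
        using inj_onD[OF inj, of "nat x" "nat y"] by (simp add: nat_less_iff eq_nat_nat_iff)
    qed
    show "(\<lambda>n. rho ^^ nat n) ` {0..<4} = surface_symmetries nonagon_surface"
      unfolding symmetries_nonagon nat_image[symmetric] image_image ..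
  qed
  then show ?thesis
    unfolding iso_def hom_def
    by (auto simp: carrier_integer_mod_group symmetry_group_def add symmetries_nonagon)
qed

theorem mainTheorem1:
  shows "polyhedral_surface nonagon_surface
    \<and> closed_surface nonagon_surface
    \<and> orientable_surface nonagon_surface
    \<and> equivelar nonagon_surface 9 3
    \<and> has_genus nonagon_surface 3
    \<and> surface_vertices nonagon_surface = vert ` {1..24}
    \<and> card (surface_vertices nonagon_surface) = 24
    \<and> card (surface_edges nonagon_surface) = 36
    \<and> card (surface_faces nonagon_surface) = 8
    \<and> group (symmetry_group nonagon_surface)
    \<and> symmetry_group nonagon_surface \<cong> integer_mod_group 4"
proof -
  note counts = surface_vertices_nonagon card_surface_vertices_nonagon card_surface_edges_nonagon
    card_surface_faces_nonagon
  have genus: "has_genus nonagon_surface 3"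
    using closed_surface_nonagon orientable_surface_nonagon connected_surface_nonagon
    by (simp add: has_genus_def counts del: One_nat_def)
  have iso: "integer_mod_group 4 \<cong> symmetry_group nonagon_surface"
    using symmetry_group_iso by (rule is_isoI)
  have "group (symmetry_group nonagon_surface)"
    by (rule group.iso_imp_group[OF group_integer_mod_group iso monoid_symmetry_group])
  moreover have "symmetry_group nonagon_surface \<cong> integer_mod_group 4"
    using group.iso_sym[OF group_integer_mod_group iso] .
  ultimately show ?thesis
    using polyhedral_surface_nonagon closed_surface_nonagon orientable_surface_nonagon equivelar_nonagon genus
    by (simp add: counts del: One_nat_def)
qed

end
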